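(* Let $T>0$, let $n\in\mathbb{N}$, and let $P(\cdot)\in\Lambda$ (the class of $n\times n$ matrix functions defined in the context). Suppose there exist a diagonal matrix function $B(t)$ with continuous and $T$-periodic diagonal entries $b_{ii}(t)$, and numbers $p_i\in[1,\infty]$, $1\le i\le n$, satisfying $$P(t)\le B(t)\quad\forall\,t\in\mathbb{R},$$ $$\|b_{ii}^+\|_{p_i}<\beta_{p_i}^{ant}\ \text{ if } p_i\in(1,\infty],\qquad \|b_{ii}^+\|_{p_i}\le\beta_{p_i}^{ant}\ \text{ if } p_i=1 .$$ Then the system $u''(t)+P(t)u(t)=0$, $t\in\mathbb{R}$, is stably bounded.
   Context: For symmetric real $n\times n$ matrices, $C\le D$ means that $D-C$ is positive semidefinite. $\langle\cdot,\cdot\rangle$ is the usual inner product of $\mathbb{R}^n$. $\Lambda$ is the set of real $n\times n$ symmetric matrix valued functions $P(\cdot)$ with continuous and $T$-periodic entries $p_{ij}(t)$, such that the system $u''(t)+P(t)u(t)=0$, $t\in\mathbb{R}$, has no nontrivial constant solutions and $\int_0^T\langle P(t)k,k\rangle\,dt\ge 0$ for all $k\in\mathbb{R}^n$. The system $u''+P(t)u=0$ with $P\in\Lambda$ is called stably bounded if there exists $\varepsilon=\varepsilon(P)>0$ such that for every $Q(\cdot)=(q_{ij}(\cdot))\in\Lambda$ with $\max_{1\le i,j\le n}\int_0^T|p_{ij}(t)-q_{ij}(t)|\,dt<\varepsilon$, all solutions of $u''(t)+Q(t)u(t)=0$, $t\in\mathbb{R}$, are bounded. For $1\le p\le\infty$,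 $\beta_p^{ant}=\inf\|a^+\|_p$, where the infimum is over all $T$-periodic $a:\mathbb{R}\to\mathbb{R}$ with $a|_{[0,T]}\in L^1(0,T)\cap L^p(0,T)$ for which the scalar antiperiodic problem $u''(t)+a(t)u(t)=0$ on $(0,T)$, $u(0)+u(T)=u'(0)+u'(T)=0$, has nontrivial solutions. Here $a^+=\max(a,0)$ and $\|\cdot\|_p$ is the $L^p(0,T)$ norm. *)

theory Defs
  imports "HOL-Analysis.Analysis" "HOL-Probability.Essential_Supremum"
begin

section \<open>Linear systems with periodic coefficients\<close>

text \<open>Intended for symmetric matrices only; symmetry of \<open>C\<close> and \<open>D\<close> is not part of the definition.\<close>
definition loewner_le :: "real^'n^'n \<Rightarrow> real^'n^'n \<Rightarrow> bool" where
  "loewner_le C D \<longleftrightarrow> (\<forall>x. 0 \<le> ((D - C) *v x) \<bullet> x)"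

definition system_solution :: "(real \<Rightarrow> real^'n^'n) \<Rightarrow> (real \<Rightarrow> real^'n) \<Rightarrow> bool" where
  "system_solution P u \<longleftrightarrow> (\<exists>u' u''. \<forall>t.
      (u has_vector_derivative u' t) (at t) \<and>
      (u' has_vector_derivative u'' t) (at t) \<and>
      u'' t + P t *v u t = 0)"

definition Lambda :: "real \<Rightarrow> (real \<Rightarrow> real^'n^'n) set" where
  "Lambda T = {P.
      (\<forall>t. transpose (P t) = P t) \<and>
      (\<forall>i j. continuous_on UNIV (\<lambda>t. P t $ i $ j)) \<and>
      (\<forall>i j t. P (t + T) $ i $ j = P t $ i $ j) \<and>
      (\<forall>c. system_solution P (\<lambda>t. c) \<longrightarrow> c = 0) \<and>
      (\<forall>k. 0 \<le> integral {0..T} (\<lambda>t. (P t *v k) \<bullet> k))}"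

definition stably_bounded :: "real \<Rightarrow> (real \<Rightarrow> real^'n^'n) \<Rightarrow> bool" where
  "stably_bounded T P \<longleftrightarrow> (\<exists>\<epsilon>>0. \<forall>Q\<in>Lambda T.
      Max (range (\<lambda>(i, j). integral {0..T} (\<lambda>t. \<bar>P t $ i $ j - Q t $ i $ j\<bar>))) < \<epsilon> \<longrightarrow>
      (\<forall>u. system_solution Q u \<longrightarrow> bounded (range u)))"


section \<open>Lebesgue norms on an interval\<close>

definition Lp_space :: "ereal \<Rightarrow> real \<Rightarrow> (real \<Rightarrow> real) set" where
  "Lp_space p T = {f \<in> borel_measurable (lebesgue_on {0..T}).
      if p = \<infinity> then esssup (lebesgue_on {0..T}) (\<lambda>t. ereal \<bar>f t\<bar>) < \<infinity>
      else integrable (lebesgue_on {0..T}) (\<lambda>t. \<bar>f t\<bar> powr real_of_ereal p)}"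

text \<open>Only meaningful for \<open>1 \<le> p\<close>, \<open>0 < T\<close> and \<open>f\<close> in \<^const>\<open>Lp_space\<close>.\<close>
definition Lp_norm :: "ereal \<Rightarrow> real \<Rightarrow> (real \<Rightarrow> real) \<Rightarrow> real" where
  "Lp_norm p T f =
     (if p = \<infinity> then real_of_ereal (esssup (lebesgue_on {0..T}) (\<lambda>t. ereal \<bar>f t\<bar>))
      else (LINT t|lebesgue_on {0..T}. \<bar>f t\<bar> powr real_of_ereal p) powr (1 / real_of_ereal p))"


section \<open>The scalar antiperiodic problem\<close>

text \<open>A pair \<open>(x, y)\<close> in \<open>I\<close> encodes the interval with endpoints \<open>x \<le> y\<close>.\<close>
definition abs_continuous_fun :: "real \<Rightarrow> real \<Rightarrow> (real \<Rightarrow> real) \<Rightarrow> bool" where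
  "abs_continuous_fun a b f \<longleftrightarrow> (\<forall>\<epsilon>>0. \<exists>\<delta>>0. \<forall>I.
      finite I \<longrightarrow> (\<forall>(x, y)\<in>I. a \<le> x \<and> x \<le> y \<and> y \<le> b) \<longrightarrow>
      disjoint_family_on (\<lambda>(x, y). {x<..<y}) I \<longrightarrow>
      (\<Sum>(x, y)\<in>I. y - x) < \<delta> \<longrightarrow> (\<Sum>(x, y)\<in>I. \<bar>f y - f x\<bar>) < \<epsilon>)"

text \<open>As \<open>a\<close> is merely integrable, solutions are taken in the sense of Caratheodory: \<open>u\<close> is
  differentiable with absolutely continuous derivative \<open>u'\<close>, and the equation holds almost
  everywhere.\<close>
definition antiperiodic_solution :: "real \<Rightarrow> (real \<Rightarrow> real) \<Rightarrow> (real \<Rightarrow> real) \<Rightarrow> bool" where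
  "antiperiodic_solution T a u \<longleftrightarrow> (\<exists>u'.
      (\<forall>t\<in>{0..T}. (u has_real_derivative u' t) (at t within {0..T})) \<and>
      abs_continuous_fun 0 T u' \<and>
      (AE t in lebesgue_on {0..T}. \<exists>u''.
         (u' has_real_derivative u'') (at t within {0..T}) \<and> u'' + a t * u t = 0) \<and>
      u 0 + u T = 0 \<and> u' 0 + u' T = 0)"

definition antiperiodic_coeffs :: "ereal \<Rightarrow> real \<Rightarrow> (real \<Rightarrow> real) set" where
  "antiperiodic_coeffs p T = {a.
      (\<forall>t. a (t + T) = a t) \<and> a \<in> Lp_space 1 T \<inter> Lp_space p T \<and>
      (\<exists>u. antiperiodic_solution T a u \<and> (\<exists>t\<in>{0..T}. u t \<noteq> 0))}"

text \<open>The set under the infimum is bounded below by \<open>0\<close> and, for \<open>T > 0\<close>, nonempty: it contains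
  the norm of the constant \<open>(pi / T)\<^sup>2\<close>.\<close>
definition beta_ant :: "ereal \<Rightarrow> real \<Rightarrow> real" where
  "beta_ant p T = (INF a\<in>antiperiodic_coeffs p T. Lp_norm p T (\<lambda>t. max (a t) 0))"

end

theory Submission
  imports Defs "HOL-Complex_Analysis.Great_Picard"
begin

text \<open>Let \<open>u\<close> solve \<open>u'' + Q u = 0\<close> and \<open>z = u 0 + u T\<close>. The Wronskian of \<open>u\<close> and its translate by
  one period is conserved and equals \<open>q (u - z / 2) + 1/4 \<integral> \<langle>Q z, z\<rangle>\<close>, where
  \<open>q v = \<integral> \<bar>v'\<bar>\<^sup>2 - \<langle>Q v, v\<rangle>\<close> and \<open>u - z / 2\<close> is antiperiodic. If \<open>q\<close> is coercive on antiperiodic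
  functions, this bounds \<open>\<integral> \<bar>u'\<bar>\<^sup>2\<close> over every period, and the absence of constant solutions then
  bounds \<open>u\<close>; no Floquet theory is needed. Coercivity is stable under perturbations that are small in
  the \<open>L\<^sup>1\<close> norm, and by \<open>P \<le> B\<close> it reduces to the scalar forms with weights \<open>max b\<^sub>i\<^sub>i 0\<close>. If such a
  scalar form is not coercive, the first antiperiodic eigenvalue of the weight is at most 1, which
  yields a competitor in the infimum defining \<open>\<beta>\<close>; for \<open>p = 1\<close> a concentrated weight does strictly
  better.\<close>

section \<open>Antiperiodic functions\<close>

text \<open>Antiperiodicity excludes nonzero constants, so the integral of
  \<open>\<bar>v'\<bar>\<^sup>2\<close> controls the supremum of \<open>v\<close>. A perturbation of
  the coefficients then enters only through the integrals of its entries, and maximizing sequences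
  are uniformly bounded. Constants, which antiperiodic forms do not see, are handled by the last two
  clauses of \<open>Lambda\<close>: the integral condition makes the term in \<open>z\<close>
  nonnegative, and the absence of constant solutions bounds \<open>u\<close> by the energy of
  \<open>u'\<close>.

  Only upper bounds for the infimum enter. It ranges over integrable coefficients, but the
  competitors built here are continuous and have classical solutions. Failure of coercivity for a
  weight \<open>b\<close> gives an eigenfunction for \<open>b / l\<close> with
  \<open>l \<ge> 1\<close>, so \<open>b / l\<close> is a competitor whose norm is at most that of
  \<open>b\<close>. This contradicts a strict hypothesis at once. For \<open>p = 1\<close> equality
  is allowed, so a second weight of smaller integral is built from the eigenfunction; it is again
  not coercive, and the eigenvalue argument is applied to it a second time.\<close>

definition antiper :: "real \<Rightarrow> (real \<Rightarrow> 'a::euclidean_space) \<Rightarrow> (real \<Rightarrow> 'a) \<Rightarrow> bool" where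
  "antiper T v v' \<longleftrightarrow> (\<forall>t\<in>{0..T}. (v has_vector_derivative v' t) (at t within {0..T})) \<and>
     continuous_on {0..T} v' \<and> v 0 + v T = 0"

lemma has_vector_derivative_imp_continuous_on:
  assumes "\<And>t. t \<in> S \<Longrightarrow> (v has_vector_derivative v' t) (at t within S)"
  shows "continuous_on S v"
  using assms continuous_on_eq_continuous_within has_vector_derivative_continuous by blast

lemma antiper_continuous:
  assumes "antiper T v v'"
  shows "continuous_on {0..T} v" "continuous_on {0..T} v'"
  using assms has_vector_derivative_imp_continuous_on[of "{0..T}" v v']
  by (auto simp: antiper_def)

lemma increment_bound:
  fixes v :: "real \<Rightarrow> 'a::euclidean_space"
  assumes der: "\<And>t. t \<in> {a..b} \<Longrightarrow> (v has_vector_derivative v' t) (at t within {a..b})"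
    and cont: "continuous_on {a..b} v'" and st: "s \<in> {a..b}" "t \<in> {a..b}"
  shows "(norm (v t - v s))\<^sup>2 \<le> \<bar>t - s\<bar> * integral {a..b} (\<lambda>x. (norm (v' x))\<^sup>2)"
proof -
  have *: "(norm (v t - v s))\<^sup>2 \<le> (t - s) * integral {a..b} (\<lambda>x. (norm (v' x))\<^sup>2)"
    if le: "s < t" and s: "s \<in> {a..b}" and t: "t \<in> {a..b}" for s t
  proof -
    define d where "d = v t - v s"
    let ?r = "t - s"
    have sub: "{s..t} \<subseteq> {a..b}" using s t by auto
    have c1: "continuous_on {s..t} v'" using cont sub continuous_on_subset by blast
    have "((\<lambda>x. v' x \<bullet> d) has_integral (v t \<bullet> d - v s \<bullet> d)) {s..t}"
    proof (rule fundamental_theorem_of_calculus)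
      show "((\<lambda>x. v x \<bullet> d) has_vector_derivative v' x \<bullet> d) (at x within {s..t})"
        if "x \<in> {s..t}" for x
        by (rule bounded_linear.has_vector_derivative[OF bounded_linear_inner_left])
          (use that sub der has_vector_derivative_within_subset in blast)
    qed (use le in auto)
    then have 1: "(norm d)\<^sup>2 = integral {s..t} (\<lambda>x. v' x \<bullet> d)"
      by (simp add: d_def power2_norm_eq_inner inner_diff_left integral_unique)
    \<comment> \<open>Young's inequality with weight \<open>?r\<close>: its constant term integrates
      over length \<open>?r\<close> to half of \<open>(norm d)\<^sup>2\<close>, which the left side
      absorbs.\<close>
    have "integral {s..t} (\<lambda>x. v' x \<bullet> d)
        \<le> integral {s..t} (\<lambda>x. (?r / 2) * (norm (v' x))\<^sup>2 + (norm d)\<^sup>2 / (2 * ?r))"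
    proof (rule integral_le)
      show "v' x \<bullet> d \<le> ?r / 2 * (norm (v' x))\<^sup>2 + (norm d)\<^sup>2 / (2 * ?r)" for x
      proof -
        have "0 \<le> (norm (?r *\<^sub>R v' x - d))\<^sup>2" by simp
        also have "\<dots> = ?r\<^sup>2 * (norm (v' x))\<^sup>2 - 2 * ?r * (v' x \<bullet> d) + (norm d)\<^sup>2"
          unfolding power2_norm_eq_inner
          by (simp add: inner_diff_left inner_diff_right inner_commute power2_eq_square algebra_simps)
        finally have "2 * ?r * (v' x \<bullet> d) \<le> ?r\<^sup>2 * (norm (v' x))\<^sup>2 + (norm d)\<^sup>2" by simp
        then show ?thesis using le by (simp add: field_simps power2_eq_square)
      qed
    qed (intro integrable_continuous_real continuous_intros c1)+
    also have "\<dots> = ?r / 2 * integral {s..t} (\<lambda>x. (norm (v' x))\<^sup>2) + (norm d)\<^sup>2 / 2"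
    proof (rule integral_unique, rule has_integral_add)
      show "((\<lambda>x. ?r / 2 * (norm (v' x))\<^sup>2) has_integral
          ?r / 2 * integral {s..t} (\<lambda>x. (norm (v' x))\<^sup>2)) {s..t}"
        by (intro has_integral_mult_right integrable_integral integrable_continuous_real
            continuous_intros c1)
      have "measure lborel {s..t} *\<^sub>R ((norm d)\<^sup>2 / (2 * ?r)) = (norm d)\<^sup>2 / 2"
        using le by (simp add: divide_simps)
      then show "((\<lambda>x. (norm d)\<^sup>2 / (2 * ?r)) has_integral (norm d)\<^sup>2 / 2) {s..t}"
        using has_integral_const_real[of "(norm d)\<^sup>2 / (2 * ?r)" s t] by metis
    qed
    finally have "(norm d)\<^sup>2 \<le> ?r * integral {s..t} (\<lambda>x. (norm (v' x))\<^sup>2)"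
      using 1 by simp
    also have "\<dots> \<le> ?r * integral {a..b} (\<lambda>x. (norm (v' x))\<^sup>2)"
      using le by (intro mult_left_mono integral_subset_le sub integrable_continuous_real
          continuous_intros c1 cont) auto
    finally show ?thesis by (simp add: d_def)
  qed
  consider "s < t" | "t < s" | "s = t" by linarith
  then show ?thesis
    by cases (use *[of s t] *[of t s] st in \<open>auto simp: norm_minus_commute\<close>)
qed

lemma antiper_deriv_cong:
  assumes "antiper T v z" "\<And>t. t \<in> {0..T} \<Longrightarrow> z t = z' t"
  shows "antiper T v z'"
  unfolding antiper_def
proof (intro conjI ballI)
  show "continuous_on {0..T} z'"
    using assms(1) by (intro continuous_on_eq[OF _ assms(2)]) (simp_all add: antiper_def)
qed (use assms in \<open>simp_all add: antiper_def\<close>)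

text \<open>Antiperiodicity writes \<open>2 v t\<close> as the sum of the increments of
  \<open>v\<close> from \<open>0\<close> and from \<open>T\<close> to \<open>t\<close>, and
  \<open>increment_bound\<close> controls each of them.\<close>

lemma antiper_sup_bound:
  fixes v :: "real \<Rightarrow> 'a::euclidean_space"
  assumes v: "antiper T v v'" and t: "t \<in> {0..T}"
  shows "(norm (v t))\<^sup>2 \<le> T * integral {0..T} (\<lambda>x. (norm (v' x))\<^sup>2)"
proof -
  let ?N = "integral {0..T} (\<lambda>x. (norm (v' x))\<^sup>2)"
  have N: "0 \<le> ?N" by (intro integral_nonneg integrable_continuous_real continuous_intros
        antiper_continuous[OF v]) auto
  have inc: "(norm (v t - v s))\<^sup>2 \<le> T * ?N" if "s \<in> {0..T}" for s
  proof -
    have "(norm (v t - v s))\<^sup>2 \<le> \<bar>t - s\<bar> * ?N"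
      by (rule increment_bound) (use v t that in \<open>auto simp: antiper_def\<close>)
    also have "\<dots> \<le> T * ?N" using N t that by (intro mult_right_mono) auto
    finally show ?thesis .
  qed
  have "v T = - v 0" using v by (simp add: antiper_def eq_neg_iff_add_eq_0 add.commute)
  then have "2 *\<^sub>R v t = (v t - v 0) + (v t - v T)" by (simp add: scaleR_2)
  then have "2 * norm (v t) \<le> norm (v t - v 0) + norm (v t - v T)"
    by (metis norm_scaleR norm_triangle_ineq abs_numeral)
  also have "\<dots> \<le> sqrt (T * ?N) + sqrt (T * ?N)"
    using t by (intro add_mono real_le_rsqrt inc) auto
  finally have "norm (v t) \<le> sqrt (T * ?N)" by simp
  then have "(norm (v t))\<^sup>2 \<le> (sqrt (T * ?N))\<^sup>2" by (intro power_mono) auto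
  then show ?thesis using N t by simp
qed

text \<open>This constant of integration is the only one that makes the values at \<open>0\<close>
  and \<open>T\<close> opposite; the operation inverts differentiation on antiperiodic
  functions.\<close>

definition antiprim :: "real \<Rightarrow> (real \<Rightarrow> real) \<Rightarrow> real \<Rightarrow> real" where
  "antiprim T f t = integral {0..t} f - integral {0..T} f / 2"

lemma antiper_antiprim:
  assumes "0 \<le> T" "continuous_on {0..T} f"
  shows "antiper T (antiprim T f) f"
  unfolding antiper_def antiprim_def
  using assms integral_has_vector_derivative[of 0 T f]
  by (auto intro!: derivative_eq_intros)

lemma antiprim_bound:
  assumes T: "0 \<le> T" and f: "continuous_on {0..T} f" and M: "\<And>t. t \<in> {0..T} \<Longrightarrow> \<bar>f t\<bar> \<le> M"
    and t: "t \<in> {0..T}"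
  shows "\<bar>antiprim T f t\<bar> \<le> 2 * T * M"
proof -
  have M0: "0 \<le> M" using M[OF t] by linarith
  have "norm (integral {0..s} f) \<le> M * (s - 0)" if "s \<in> {0..T}" for s
    by (rule integral_bound) (use that f M in \<open>auto intro: continuous_on_subset\<close>)
  from this[of t] this[of T] have "\<bar>integral {0..t} f\<bar> \<le> M * t" "\<bar>integral {0..T} f\<bar> \<le> M * T"
    using t by auto
  moreover have "M * t \<le> M * T" using M0 t by (intro mult_left_mono) auto
  ultimately have "\<bar>antiprim T f t\<bar> \<le> M * T + M * T / 2" unfolding antiprim_def by linarith
  also have "\<dots> \<le> 2 * T * M" using M0 T by (simp add: mult.commute mult_nonneg_nonneg)
  finally show ?thesis .
qed

lemma antiprim_diff:
  assumes "continuous_on {0..T} f" "continuous_on {0..T} g" "t \<in> {0..T}"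
  shows "antiprim T (\<lambda>x. f x - g x) t = antiprim T f t - antiprim T g t"
proof -
  have "integral {0..s} (\<lambda>x. f x - g x) = integral {0..s} f - integral {0..s} g" if "s \<in> {0..T}" for s
    by (intro integral_diff integrable_continuous_real)
      (use assms that in \<open>auto intro: continuous_on_subset\<close>)
  from this[of t] this[of T] show ?thesis using assms(3) by (simp add: antiprim_def field_simps)
qed

lemma antiper_scale:
  assumes "antiper T v v'"
  shows "antiper T (\<lambda>t. c *\<^sub>R v t) (\<lambda>t. c *\<^sub>R v' t)"
  using assms unfolding antiper_def
  by (auto intro!: derivative_eq_intros continuous_intros simp flip: scaleR_add_right)

lemma antiper_diff:
  assumes v: "antiper T v v'" and w: "antiper T w w'"
  shows "antiper T (\<lambda>t. v t - w t) (\<lambda>t. v' t - w' t)"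
  unfolding antiper_def
proof (intro conjI ballI)
  have "v T = - v 0" "w T = - w 0"
    using v w by (auto simp: antiper_def eq_neg_iff_add_eq_0 add.commute)
  then show "v 0 - w 0 + (v T - w T) = 0" by simp
qed (use v w in \<open>auto simp: antiper_def intro!: has_vector_derivative_diff continuous_on_diff\<close>)

text \<open>Both factors change sign from \<open>0\<close> to \<open>T\<close>, so their product
  takes the same value at both ends and the boundary terms cancel.\<close>

lemma antiper_by_parts:
  fixes v w :: "real \<Rightarrow> real"
  assumes T: "0 \<le> T" and v: "antiper T v v'" and w: "antiper T w w'"
  shows "integral {0..T} (\<lambda>t. v' t * w t) = - integral {0..T} (\<lambda>t. v t * w' t)"
proof -
  note c = antiper_continuous[OF v] antiper_continuous[OF w]
  have "((\<lambda>t. v t * w' t + v' t * w t) has_integral v T * w T - v 0 * w 0) {0..T}"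
    by (rule fundamental_theorem_of_calculus[OF T], rule has_vector_derivative_mult)
      (use v w in \<open>auto simp: antiper_def\<close>)
  moreover have "v T * w T - v 0 * w 0 = 0"
  proof -
    have "v T = - v 0" "w T = - w 0" using v w by (auto simp: antiper_def)
    then show ?thesis by simp
  qed
  moreover have "integral {0..T} (\<lambda>t. v t * w' t + v' t * w t)
     = integral {0..T} (\<lambda>t. v t * w' t) + integral {0..T} (\<lambda>t. v' t * w t)"
    by (intro integral_add integrable_continuous_real continuous_intros c)
  ultimately show ?thesis by (auto dest!: integral_unique)
qed


section \<open>The first antiperiodic eigenvalue\<close>

lemma weighted_le_sup:
  fixes v a :: "real \<Rightarrow> real"
  assumes "continuous_on {0..T} a" "\<And>t. t \<in> {0..T} \<Longrightarrow> 0 \<le> a t" "continuous_on {0..T} v"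
    and "\<And>t. t \<in> {0..T} \<Longrightarrow> (v t)\<^sup>2 \<le> M"
  shows "integral {0..T} (\<lambda>t. a t * (v t)\<^sup>2) \<le> integral {0..T} a * M"
proof -
  have "integral {0..T} (\<lambda>t. a t * (v t)\<^sup>2) \<le> integral {0..T} (\<lambda>t. a t * M)"
    using assms by (intro integral_le integrable_continuous_real continuous_intros mult_left_mono) auto
  then show ?thesis by simp
qed

definition energy :: "real \<Rightarrow> (real \<Rightarrow> real) \<Rightarrow> real" where
  "energy T v' = integral {0..T} (\<lambda>t. (v' t)\<^sup>2)"

definition weight :: "real \<Rightarrow> (real \<Rightarrow> real) \<Rightarrow> (real \<Rightarrow> real) \<Rightarrow> real" where
  "weight T a v = integral {0..T} (\<lambda>t. a t * (v t)\<^sup>2)"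

lemma energy_nonneg: "continuous_on {0..T} v' \<Longrightarrow> 0 \<le> energy T v'"
  unfolding energy_def by (intro integral_nonneg integrable_continuous_real continuous_intros) auto

lemma real_antiper_sup_bound:
  "antiper T v v' \<Longrightarrow> t \<in> {0..T} \<Longrightarrow> (v t :: real)\<^sup>2 \<le> T * energy T v'"
  using antiper_sup_bound[of T v v' t] by (simp add: energy_def)

text \<open>The supremum of this set is the reciprocal of the first antiperiodic eigenvalue.\<close>
definition rayleigh :: "real \<Rightarrow> (real \<Rightarrow> real) \<Rightarrow> real set" where
  "rayleigh T a = {weight T a v | v v'. antiper T v v' \<and> energy T v' = 1}"

locale nonneg_weight =
  fixes T :: real and a :: "real \<Rightarrow> real"
  assumes T: "0 < T" and a: "continuous_on {0..T} a" "\<And>t. t \<in> {0..T} \<Longrightarrow> 0 \<le> a t"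
begin

lemma weight_le: "antiper T v v' \<Longrightarrow> weight T a v \<le> integral {0..T} a * (T * energy T v')"
  unfolding weight_def
  by (intro weighted_le_sup a antiper_continuous real_antiper_sup_bound)

lemma quotient_mem_rayleigh:
  assumes v: "antiper T v v'" and pos: "0 < energy T v'"
  shows "weight T a v / energy T v' \<in> rayleigh T a"
proof -
  define c where "c = 1 / sqrt (energy T v')"
  have c2: "c\<^sup>2 = 1 / energy T v'" using pos by (simp add: c_def power_divide)
  have "weight T a (\<lambda>t. c * v t) = c\<^sup>2 * weight T a v"
    unfolding weight_def by (simp add: power_mult_distrib mult.left_commute flip: integral_mult_right)
  moreover have "energy T (\<lambda>t. c * v' t) = c\<^sup>2 * energy T v'"
    unfolding energy_def by (simp add: power_mult_distrib)
  ultimately show ?thesis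
    unfolding rayleigh_def using antiper_scale[OF v, of c] c2 pos
    by (intro CollectI exI[of _ "\<lambda>t. c * v t"] exI[of _ "\<lambda>t. c * v' t"]) auto
qed

lemma weight_le_rayleigh:
  assumes v: "antiper T v v'"
  shows "weight T a v \<le> Sup (rayleigh T a) * energy T v'"
proof (cases "energy T v' = 0")
  case True
  then show ?thesis using weight_le[OF v] by simp
next
  case False
  then have pos: "0 < energy T v'"
    using energy_nonneg[OF antiper_continuous(2)[OF v]] by linarith
  have "bdd_above (rayleigh T a)"
    by (rule bdd_aboveI[of _ "integral {0..T} a * T"])
      (use weight_le in \<open>fastforce simp: rayleigh_def\<close>)
  with quotient_mem_rayleigh[OF v pos] have "weight T a v / energy T v' \<le> Sup (rayleigh T a)"
    by (rule cSup_upper)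
  then show ?thesis using pos by (simp add: field_simps)
qed

text \<open>Two antiperiodic integrations solve \<open>u'' = - a v\<close> with \<open>u\<close> and
  \<open>u'\<close> antiperiodic. Hence \<open>green v = l * v\<close> encodes the antiperiodic
  problem for the weight \<open>a / l\<close>.\<close>

definition green :: "(real \<Rightarrow> real) \<Rightarrow> real \<Rightarrow> real" where
  "green v = antiprim T (antiprim T (\<lambda>t. - (a t * v t)))"

lemma green_antiper:
  assumes "continuous_on {0..T} v"
  shows "antiper T (green v) (antiprim T (\<lambda>t. - (a t * v t)))"
    "antiper T (antiprim T (\<lambda>t. - (a t * v t))) (\<lambda>t. - (a t * v t))"
proof -
  show *: "antiper T (antiprim T (\<lambda>t. - (a t * v t))) (\<lambda>t. - (a t * v t))"
    by (rule antiper_antiprim) (use T a assms in \<open>auto intro!: continuous_intros\<close>)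
  show "antiper T (green v) (antiprim T (\<lambda>t. - (a t * v t)))"
    unfolding green_def by (rule antiper_antiprim) (use T antiper_continuous(1)[OF *] in auto)
qed

text \<open>In the energy inner product \<open>green v\<close> represents the weighted form; thus
  \<open>green\<close> is symmetric and nonnegative there, with norm
  \<open>Sup (rayleigh T a)\<close>.\<close>

lemma green_weak:
  assumes v: "continuous_on {0..T} v" and w: "antiper T w w'"
  shows "integral {0..T} (\<lambda>t. antiprim T (\<lambda>t. - (a t * v t)) t * w' t)
    = integral {0..T} (\<lambda>t. a t * v t * w t)"
  using antiper_by_parts[OF _ green_antiper(2)[OF v] w] T by simp

text \<open>Each integration costs a factor \<open>2 * T\<close> and the weight a factor
  \<open>A\<close>. This continuity lets a uniform limit pass through \<open>green\<close>.\<close>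

lemma green_diff_bound:
  assumes v: "continuous_on {0..T} v" and w: "continuous_on {0..T} w"
    and A: "\<And>t. t \<in> {0..T} \<Longrightarrow> a t \<le> A" and M: "\<And>t. t \<in> {0..T} \<Longrightarrow> \<bar>v t - w t\<bar> \<le> M"
    and t: "t \<in> {0..T}"
  shows "\<bar>green v t - green w t\<bar> \<le> 4 * T\<^sup>2 * A * M"
proof -
  let ?f = "\<lambda>v t. - (a t * v t)"
  have cf: "continuous_on {0..T} (?f v)" "continuous_on {0..T} (?f w)"
    using a v w by (auto intro!: continuous_intros)
  note cJ = green_antiper(2)[THEN antiper_continuous(1)]
  have T0: "0 \<le> T" using T by simp
  have 1: "\<bar>antiprim T (?f v) s - antiprim T (?f w) s\<bar> \<le> 2 * T * (A * M)" if s: "s \<in> {0..T}" for s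
  proof -
    have "\<bar>antiprim T (\<lambda>t. ?f v t - ?f w t) s\<bar> \<le> 2 * T * (A * M)"
    proof (rule antiprim_bound[OF T0 _ _ s])
      fix x assume x: "x \<in> {0..T}"
      have "\<bar>?f v x - ?f w x\<bar> = a x * \<bar>v x - w x\<bar>"
        using a(2)[OF x] by (simp add: abs_mult abs_minus_commute flip: right_diff_distrib)
      also have "\<dots> \<le> A * M" using a(2)[OF x] A[OF x] M[OF x] by (intro mult_mono) auto
      finally show "\<bar>?f v x - ?f w x\<bar> \<le> A * M" .
    qed (intro continuous_intros cf)
    then show ?thesis using antiprim_diff[OF cf s] by simp
  qed
  have "\<bar>antiprim T (\<lambda>s. antiprim T (?f v) s - antiprim T (?f w) s) t\<bar> \<le> 2 * T * (2 * T * (A * M))"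
    by (rule antiprim_bound[OF T0 _ 1 t]) (auto intro!: continuous_intros cJ v w)
  then show ?thesis
    using antiprim_diff[OF cJ[OF v] cJ[OF w] t] by (simp add: green_def power2_eq_square mult_ac)
qed

text \<open>Expand the square. The energy of \<open>green v\<close> is at most
  \<open>?l\<^sup>2 * energy T v'\<close>, and the cross term is \<open>- 2 * ?l\<close> times the
  weight. Near-maximizers are therefore near-eigenvectors.\<close>

lemma green_energy_defect:
  assumes v: "antiper T v v'" and l: "0 < Sup (rayleigh T a)" (is "0 < ?l")
  shows "energy T (\<lambda>t. ?l * v' t - antiprim T (\<lambda>t. - (a t * v t)) t)
    \<le> 2 * ?l * (?l * energy T v' - weight T a v)"
proof -
  note cv = antiper_continuous[OF v]
  define u where "u = green v"
  define u' where "u' = antiprim T (\<lambda>t. - (a t * v t))"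
  have u: "antiper T u u'" unfolding u_def u'_def by (rule green_antiper(1)[OF cv(1)])
  note cu = antiper_continuous[OF u]
  have ip: "integral {0..T} (\<lambda>t. u' t * v' t) = weight T a v"
    using green_weak[OF cv(1) v] by (simp add: u'_def weight_def power2_eq_square mult.assoc)
  have E: "energy T u' = integral {0..T} (\<lambda>t. a t * v t * u t)"
    using green_weak[OF cv(1) u] by (simp add: u'_def energy_def power2_eq_square)
  \<comment> \<open>AM-GM weighted by \<open>?l\<close>, followed by the Rayleigh bound for both
    \<open>v\<close> and \<open>u\<close>, gives
    \<open>?l\<^sup>2 * energy T v' + energy T u'\<close> on the right; the last term is
    absorbed.\<close>
  have "2 * energy T u' = integral {0..T} (\<lambda>t. 2 * (a t * v t * u t))"
    unfolding E by simp
  also have "\<dots> \<le> integral {0..T} (\<lambda>t. ?l * (a t * (v t)\<^sup>2) + (1 / ?l) * (a t * (u t)\<^sup>2))"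
  proof (rule integral_le)
    fix t assume t: "t \<in> {0..T}"
    have "0 \<le> a t * (?l * v t - u t)\<^sup>2 / ?l" using a(2)[OF t] l by simp
    also have "\<dots> = ?l * (a t * (v t)\<^sup>2) + (1 / ?l) * (a t * (u t)\<^sup>2) - 2 * (a t * v t * u t)"
      using l by (simp add: power2_eq_square divide_simps) (simp add: algebra_simps)
    finally show "2 * (a t * v t * u t) \<le> ?l * (a t * (v t)\<^sup>2) + (1 / ?l) * (a t * (u t)\<^sup>2)" by simp
  qed (intro integrable_continuous_real continuous_intros cu cv a)+
  also have "\<dots> = integral {0..T} (\<lambda>t. ?l * (a t * (v t)\<^sup>2)) + integral {0..T} (\<lambda>t. (1 / ?l) * (a t * (u t)\<^sup>2))"
    by (intro integral_add integrable_continuous_real continuous_intros cu cv a)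
  also have "\<dots> = ?l * weight T a v + (1 / ?l) * weight T a u"
    by (simp only: weight_def integral_mult_right)
  also have "\<dots> \<le> ?l * (?l * energy T v') + (1 / ?l) * (?l * energy T u')"
    using l by (intro add_mono mult_left_mono weight_le_rayleigh[OF v] weight_le_rayleigh[OF u]) auto
  finally have Eu: "energy T u' \<le> ?l\<^sup>2 * energy T v'"
    using l by (simp add: power2_eq_square)
  have "energy T (\<lambda>t. ?l * v' t - u' t) =
     integral {0..T} (\<lambda>t. ?l\<^sup>2 * (v' t)\<^sup>2 - (2 * ?l) * (u' t * v' t) + (u' t)\<^sup>2)"
    unfolding energy_def by (rule integral_cong) (simp add: power2_eq_square algebra_simps)
  also have "\<dots> = integral {0..T} (\<lambda>t. ?l\<^sup>2 * (v' t)\<^sup>2 - (2 * ?l) * (u' t * v' t)) + integral {0..T} (\<lambda>t. (u' t)\<^sup>2)"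
    by (intro integral_add integrable_continuous_real continuous_intros cu cv)
  also have "integral {0..T} (\<lambda>t. ?l\<^sup>2 * (v' t)\<^sup>2 - (2 * ?l) * (u' t * v' t)) =
     integral {0..T} (\<lambda>t. ?l\<^sup>2 * (v' t)\<^sup>2) - integral {0..T} (\<lambda>t. (2 * ?l) * (u' t * v' t))"
    by (intro integral_diff integrable_continuous_real continuous_intros cu cv)
  finally have "energy T (\<lambda>t. ?l * v' t - u' t) = ?l\<^sup>2 * energy T v' - 2 * ?l * weight T a v + energy T u'"
    by (simp only: energy_def ip integral_mult_right)
  with Eu show ?thesis by (simp add: u'_def power2_eq_square algebra_simps)
qed

text \<open>If the supremum \<open>l\<close> were below 1, the Rayleigh bound would be coercivity
  with constant \<open>1 - l\<close>.\<close>

lemma one_le_rayleigh: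
  assumes H: "\<And>c. 0 < c \<Longrightarrow> \<exists>v v'. antiper T v v' \<and> energy T v' - weight T a v < c * energy T v'"
  shows "1 \<le> Sup (rayleigh T a)"
proof (rule ccontr)
  assume "\<not> ?thesis"
  then obtain v v' where v: "antiper T v v'"
    and *: "energy T v' - weight T a v < (1 - Sup (rayleigh T a)) * energy T v'"
    using H[of "1 - Sup (rayleigh T a)"] by auto
  then show False using weight_le_rayleigh[OF v] by (simp add: algebra_simps)
qed

text \<open>A maximizing sequence for the Rayleigh quotient has a uniformly convergent subsequence by
  Arzela-Ascoli; since it is asymptotically an eigenvector of the Green operator, which is bounded
  for the sup norm, the limit is an exact eigenvector and hence twice differentiable.\<close>

lemma eigenfunction_exists:
  assumes H: "\<And>c. 0 < c \<Longrightarrow> \<exists>v v'. antiper T v v' \<and> energy T v' - weight T a v < c * energy T v'"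
  obtains l w w' where "1 \<le> l" "antiper T w w'" "antiper T w' (\<lambda>t. - (a t / l) * w t)"
    "\<exists>t\<in>{0..T}. w t \<noteq> 0"
proof -
  define l where "l = Sup (rayleigh T a)"
  have l1: "1 \<le> l" using one_le_rayleigh[OF H] by (simp add: l_def)
  have T0: "0 \<le> T" using T by simp
  have ne: "rayleigh T a \<noteq> {}"
  proof -
    \<comment> \<open>With \<open>c = 1\<close> the hypothesis says that the weight is positive,
      which rules out zero energy.\<close>
    obtain v v' where v: "antiper T v v'" and *: "energy T v' - weight T a v < 1 * energy T v'"
      using H[of 1] by auto
    have "energy T v' \<noteq> 0" using * weight_le[OF v] by auto
    then show ?thesis
      using quotient_mem_rayleigh[OF v] energy_nonneg[OF antiper_continuous(2)[OF v]] by force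
  qed
  have "\<exists>v v'. antiper T v v' \<and> energy T v' = 1 \<and> l - 1 / real (Suc n) < weight T a v" for n
  proof -
    have "l - 1 / real (Suc n) < Sup (rayleigh T a)" by (simp add: l_def)
    from less_cSupD[OF ne this] show ?thesis by (auto simp: rayleigh_def)
  qed
  then obtain v v' where v: "\<And>n. antiper T (v n) (v' n)" and E1: "\<And>n. energy T (v' n) = 1"
    and W: "\<And>n. l - 1 / real (Suc n) < weight T a (v n)" by metis
  note cv = antiper_continuous[OF v]
  obtain g k where g: "continuous_on {0..T} g" and k: "strict_mono (k :: nat \<Rightarrow> nat)"
    and lim: "\<And>e. 0 < e \<Longrightarrow> \<exists>N. \<forall>n x. n \<ge> N \<and> x \<in> {0..T} \<longrightarrow> norm (v (k n) x - g x) < e"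
  proof (rule Arzela_Ascoli[of "{0..T}" v "sqrt T"])
    show "norm (v n x) \<le> sqrt T" if "x \<in> {0..T}" for n x
      using real_antiper_sup_bound[OF v[of n] that] E1[of n] by (simp add: real_le_rsqrt)
    show "\<exists>d>0. \<forall>n y. y \<in> {0..T} \<and> norm (x - y) < d \<longrightarrow> norm (v n x - v n y) < e"
      if x: "x \<in> {0..T}" and e: "0 < e" for x e
    \<comment> \<open>Unit energy makes the sequence uniformly Hoelder continuous with exponent 1/2,
      hence the choice \<open>e\<^sup>2\<close>.\<close>
    proof (intro exI[of _ "e\<^sup>2"] conjI allI impI)
      fix n y assume y: "y \<in> {0..T} \<and> norm (x - y) < e\<^sup>2"
      have "(norm (v n x - v n y))\<^sup>2 \<le> \<bar>x - y\<bar> * integral {0..T} (\<lambda>x. (norm (v' n x))\<^sup>2)"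
        by (rule increment_bound) (use v x y in \<open>auto simp: antiper_def\<close>)
      also have "\<dots> < e\<^sup>2" using y E1[of n] by (simp add: energy_def)
      finally show "norm (v n x - v n y) < e" using e by (simp add: power2_less_imp_less)
    qed (use e in auto)
  qed auto
  have Wk: "l - 1 / real (Suc n) < weight T a (v (k n))" for n
  proof -
    have "n \<le> k n" using k by (rule strict_mono_imp_increasing)
    then have "1 / real (Suc (k n)) \<le> 1 / real (Suc n)" by (simp add: frac_le)
    then show ?thesis using W[of "k n"] by linarith
  qed
  obtain A where A: "\<And>t. t \<in> {0..T} \<Longrightarrow> a t \<le> A" and A0: "0 < A"
  proof -
    have "bounded (a ` {0..T})" using a(1) by (intro compact_imp_bounded compact_continuous_image) auto
    then obtain A where "0 < A" "\<forall>x\<in>a ` {0..T}. norm x \<le> A" by (auto simp: bounded_pos)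
    then show ?thesis by (intro that[of A]) (auto simp: abs_le_iff)
  qed
  have eig: "l * g t = green g t" if t: "t \<in> {0..T}" for t
  proof -
    have "(\<lambda>n. v (k n) t) \<longlonglongrightarrow> g t"
      unfolding LIMSEQ_iff using lim t by meson
    then have 1: "(\<lambda>n. l * v (k n) t) \<longlonglongrightarrow> l * g t" by (intro tendsto_intros)
    have 2: "(\<lambda>n. green (v (k n)) t) \<longlonglongrightarrow> green g t"
      unfolding LIMSEQ_iff
    proof (intro allI impI)
      fix e :: real assume e: "0 < e"
      let ?d = "e / (8 * T\<^sup>2 * A)"
      have d: "0 < ?d" using e T A0 by simp
      then obtain N where N: "\<And>n x. n \<ge> N \<Longrightarrow> x \<in> {0..T} \<Longrightarrow> norm (v (k n) x - g x) < ?d"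
        using lim by meson
      have "norm (green (v (k n)) t - green g t) < e" if n: "n \<ge> N" for n
      proof -
        have "\<bar>green (v (k n)) t - green g t\<bar> \<le> 4 * T\<^sup>2 * A * ?d"
          by (rule green_diff_bound[OF cv(1) g A _ t]) (use N[OF n] in \<open>auto intro: less_imp_le\<close>)
        also have "\<dots> = e / 2" using T A0 by (simp add: field_simps)
        finally show ?thesis using e by simp
      qed
      then show "\<exists>N. \<forall>n\<ge>N. norm (green (v (k n)) t - green g t) < e" by blast
    qed
    \<comment> \<open>The energy of this difference is at most \<open>2 * l\<close> times the gap
      between \<open>l\<close> and the weight, which tends to 0 along the sequence; the sup bound
      makes this pointwise.\<close>
    have "(\<lambda>n. l * v (k n) t - green (v (k n)) t) \<longlonglongrightarrow> 0"
    proof (rule Lim_null_comparison)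
      show "\<forall>\<^sub>F n in sequentially. norm (l * v (k n) t - green (v (k n)) t)
          \<le> sqrt (2 * T * l * inverse (real (Suc n)))"
      proof (intro always_eventually allI)
        fix n
        let ?d' = "\<lambda>x. l * v' (k n) x - antiprim T (\<lambda>t. - (a t * v (k n) t)) x"
        have "antiper T (\<lambda>x. l * v (k n) x - green (v (k n)) x) ?d'"
          using antiper_diff[OF antiper_scale[OF v] green_antiper(1)[OF cv(1)]] by simp
        then have "(l * v (k n) t - green (v (k n)) t)\<^sup>2 \<le> T * energy T ?d'"
          using t by (rule real_antiper_sup_bound)
        also have "\<dots> \<le> T * (2 * l * (l * energy T (v' (k n)) - weight T a (v (k n))))"
          using T l1 unfolding l_def by (intro mult_left_mono green_energy_defect[OF v]) auto
        also have "\<dots> \<le> T * (2 * l * (1 / real (Suc n)))"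
          using T l1 Wk[of n] E1[of "k n"] by (intro mult_left_mono) auto
        finally show "norm (l * v (k n) t - green (v (k n)) t) \<le> sqrt (2 * T * l * inverse (real (Suc n)))"
          by (simp add: real_le_rsqrt inverse_eq_divide mult_ac)
      qed
      have "(\<lambda>n. sqrt (2 * T * l * inverse (real (Suc n)))) \<longlonglongrightarrow> sqrt (2 * T * l * 0)"
        by (intro tendsto_intros LIMSEQ_inverse_real_of_nat)
      then show "(\<lambda>n. sqrt (2 * T * l * inverse (real (Suc n)))) \<longlonglongrightarrow> 0" by simp
    qed
    then have "l * g t - green g t = 0"
      using LIMSEQ_unique tendsto_diff[OF 1 2] by blast
    then show ?thesis by simp
  qed
  have nz: "\<exists>t\<in>{0..T}. g t \<noteq> 0"
  proof (rule ccontr)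
    assume "\<not> ?thesis"
    then have g0: "\<And>t. t \<in> {0..T} \<Longrightarrow> g t = 0" by auto
    let ?I = "integral {0..T} a"
    have I: "0 \<le> ?I" using a by (intro integral_nonneg integrable_continuous_real) auto
    \<comment> \<open>With this \<open>e\<close>, a zero limit pushes the weight below 1/2, whereas
      \<open>?n \<ge> 1\<close> keeps it above \<open>l - 1 / 2\<close>, which is at least
      1/2.\<close>
    define e where "e = sqrt (1 / (2 * (?I + 1)))"
    have e: "0 < e" "e\<^sup>2 = 1 / (2 * (?I + 1))" using I by (auto simp: e_def)
    obtain N where N: "\<And>n x. n \<ge> N \<Longrightarrow> x \<in> {0..T} \<Longrightarrow> norm (v (k n) x - g x) < e"
      using lim[OF e(1)] by meson
    let ?n = "max N 1"
    have "weight T a (v (k ?n)) \<le> ?I * e\<^sup>2"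
      unfolding weight_def
    proof (rule weighted_le_sup)
      show "(v (k ?n) t)\<^sup>2 \<le> e\<^sup>2" if t: "t \<in> {0..T}" for t
      proof -
        have "\<bar>v (k ?n) t\<bar> \<le> e" using N[of ?n t] g0[OF t] t by auto
        then show ?thesis using e(1) by (simp add: power2_le_iff_abs_le)
      qed
    qed (use a cv in auto)
    also have "?I * e\<^sup>2 < 1 / 2" unfolding e(2) using I by (simp add: divide_simps)
    also have "1 / 2 \<le> l - 1 / real (Suc ?n)"
    proof -
      have "1 / real (Suc ?n) \<le> 1 / 2" by (intro frac_le) auto
      then show ?thesis using l1 by linarith
    qed
    finally show False using Wk[of ?n] by linarith
  qed
  \<comment> \<open>\<open>g\<close> is only known to be continuous, so the eigenfunction is taken
    as \<open>green g / l\<close>, which agrees with \<open>g\<close> on the interval and comes with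
    two derivatives.\<close>
  have gr: "antiper T (\<lambda>t. (1 / l) *\<^sub>R green g t) (\<lambda>t. (1 / l) *\<^sub>R antiprim T (\<lambda>t. - (a t * g t)) t)"
    "antiper T (\<lambda>t. (1 / l) *\<^sub>R antiprim T (\<lambda>t. - (a t * g t)) t) (\<lambda>t. (1 / l) *\<^sub>R (- (a t * g t)))"
    by (rule antiper_scale[OF green_antiper(1)[OF g]], rule antiper_scale[OF green_antiper(2)[OF g]])
  have geq: "(1 / l) *\<^sub>R green g t = g t" if "t \<in> {0..T}" for t
    using eig[OF that] l1 by (simp add: field_simps)
  show thesis
  proof (rule that[OF l1 gr(1)])
    show "antiper T (\<lambda>t. (1 / l) *\<^sub>R antiprim T (\<lambda>t. - (a t * g t)) t)
       (\<lambda>t. - (a t / l) * ((1 / l) *\<^sub>R green g t))"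
      by (rule antiper_deriv_cong[OF gr(2)]) (simp only: geq, simp)
    show "\<exists>t\<in>{0..T}. (1 / l) *\<^sub>R green g t \<noteq> 0" using nz geq by metis
  qed
qed

end


section \<open>Lebesgue norms and admissible coefficients\<close>

lemma continuous_integrable_lebesgue_on:
  fixes f :: "real \<Rightarrow> real"
  assumes "continuous_on {a..b} f"
  shows "integrable (lebesgue_on {a..b}) f"
  using absolutely_integrable_continuous_real[OF assms]
  by (simp add: set_integrable_def integrable_restrict_space)

lemma continuous_in_Lp_space:
  assumes p: "1 \<le> p" and f: "continuous_on {0..T} f"
  shows "f \<in> Lp_space p T"
proof -
  have m: "f \<in> borel_measurable (lebesgue_on {0..T})"
    using continuous_integrable_lebesgue_on[OF f] by auto
  show ?thesis
  proof (cases "p = \<infinity>")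
    case True
    have "bounded (f ` {0..T})" using f by (intro compact_imp_bounded compact_continuous_image) auto
    then obtain A where A: "\<forall>x\<in>f ` {0..T}. norm x \<le> A" by (auto simp: bounded_iff)
    have "esssup (lebesgue_on {0..T}) (\<lambda>t. ereal \<bar>f t\<bar>) \<le> ereal A"
      by (rule esssup_I) (use m A in \<open>auto intro!: AE_I2\<close>)
    then have "esssup (lebesgue_on {0..T}) (\<lambda>t. ereal \<bar>f t\<bar>) < \<infinity>"
      by (metis ereal_infty_less(1) ereal_infty_less_eq(1) PInfty_neq_ereal(1))
    then show ?thesis using m True by (simp add: Lp_space_def)
  next
    case False
    then have "0 < real_of_ereal p" using p by (cases p) auto
    then have "continuous_on {0..T} (\<lambda>t. \<bar>f t\<bar> powr real_of_ereal p)"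
      by (intro continuous_on_powr' continuous_intros f) auto
    then show ?thesis using m False by (simp add: Lp_space_def continuous_integrable_lebesgue_on)
  qed
qed

lemma esssup_abs_nonneg:
  fixes T :: real and f :: "real \<Rightarrow> real"
  assumes "0 < T"
  shows "0 \<le> esssup (lebesgue_on {0..T}) (\<lambda>t. ereal \<bar>f t\<bar>)"
proof (cases "(\<lambda>t. ereal \<bar>f t\<bar>) \<in> borel_measurable (lebesgue_on {0..T})")
  case True
  \<comment> \<open>Positive measure is what makes the essential supremum of the zero function equal
    to 0. In the nonmeasurable case \<open>esssup\<close> is the top element by definition.\<close>
  have "emeasure (lebesgue_on {0..T}) (space (lebesgue_on {0..T})) \<noteq> 0"
    using assms emeasure_restrict_space[of "{0..T}" lebesgue "{0..T}"] by simp
  then have "0 = esssup (lebesgue_on {0..T}) (\<lambda>t. 0 :: ereal)" by (simp add: esssup_const)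
  also have "\<dots> \<le> esssup (lebesgue_on {0..T}) (\<lambda>t. ereal \<bar>f t\<bar>)" by (rule esssup_mono) auto
  finally show ?thesis .
qed (simp add: esssup_non_measurable)

lemma Lp_norm_nonneg: "0 < T \<Longrightarrow> 0 \<le> Lp_norm p T f"
  by (simp add: Lp_norm_def real_of_ereal_pos esssup_abs_nonneg)

lemma Lp_norm_mono:
  assumes T: "0 < T" and p: "1 \<le> p" and f: "continuous_on {0..T} f" and g: "continuous_on {0..T} g"
    and le: "\<And>t. t \<in> {0..T} \<Longrightarrow> \<bar>f t\<bar> \<le> \<bar>g t\<bar>"
  shows "Lp_norm p T f \<le> Lp_norm p T g"
proof (cases "p = \<infinity>")
  case True
  have "f \<in> borel_measurable (lebesgue_on {0..T})" using continuous_integrable_lebesgue_on[OF f] by auto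
  then have "esssup (lebesgue_on {0..T}) (\<lambda>t. ereal \<bar>f t\<bar>) \<le> esssup (lebesgue_on {0..T}) (\<lambda>t. ereal \<bar>g t\<bar>)"
    by (intro esssup_AE_mono AE_I2) (use le in auto)
  \<comment> \<open>\<open>real_of_ereal\<close> sends infinity to 0, so the larger supremum must be
    finite before passing to reals.\<close>
  moreover have "esssup (lebesgue_on {0..T}) (\<lambda>t. ereal \<bar>g t\<bar>) < \<infinity>"
    using continuous_in_Lp_space[OF p g] True by (simp add: Lp_space_def)
  ultimately show ?thesis using True esssup_abs_nonneg[OF T, of f]
    by (auto simp: Lp_norm_def intro!: real_of_ereal_positive_mono)
next
  case False
  then have q: "0 < real_of_ereal p" using p by (cases p) auto
  have i: "integrable (lebesgue_on {0..T}) (\<lambda>t. \<bar>h t\<bar> powr real_of_ereal p)" if "continuous_on {0..T} h" for h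
    using continuous_in_Lp_space[OF p that] False by (simp add: Lp_space_def)
  show ?thesis unfolding Lp_norm_def using False q le
    by (auto intro!: powr_mono2 integral_mono i f g Bochner_Integration.integral_nonneg)
qed

lemma Lp_norm_one:
  assumes f: "continuous_on {0..T} f" and pos: "\<And>t. t \<in> {0..T} \<Longrightarrow> 0 \<le> f t"
  shows "Lp_norm 1 T f = integral {0..T} f"
proof -
  have "(LINT t|lebesgue_on {0..T}. \<bar>f t\<bar> powr 1) = (LINT t|lebesgue_on {0..T}. f t)"
    by (intro Bochner_Integration.integral_cong) (use pos in auto)
  also have "\<dots> = integral {0..T} f"
    by (intro lebesgue_integral_eq_integral continuous_integrable_lebesgue_on f) auto
  moreover have "0 \<le> integral {0..T} f"
    using f pos by (intro integral_nonneg integrable_continuous_real) auto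
  ultimately show ?thesis by (simp add: Lp_norm_def)
qed

section \<open>Competitors in the infimum\<close>

lemma C1_abs_continuous:
  assumes der: "\<And>t. t \<in> {a..b} \<Longrightarrow> (f has_vector_derivative f' t) (at t within {a..b})"
    and f': "continuous_on {a..b} f'"
  shows "abs_continuous_fun a b f"
proof -
  have "bounded (f' ` {a..b})" using f' by (intro compact_imp_bounded compact_continuous_image) auto
  then obtain A where A: "0 < A" "\<forall>x\<in>f' ` {a..b}. norm x \<le> A" by (auto simp: bounded_pos)
  have lip: "\<bar>f y - f x\<bar> \<le> A * (y - x)" if "a \<le> x" "x \<le> y" "y \<le> b" for x y
  proof -
    have "norm (f y - f x) \<le> A * norm (y - x)"
    proof (rule differentiable_bound[of "{a..b}" f "\<lambda>t h. h *\<^sub>R f' t"])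
      show "onorm (\<lambda>h. h *\<^sub>R f' t) \<le> A" if "t \<in> {a..b}" for t
        using A that by (intro onorm_le) (auto simp: abs_mult mult.commute[of A] intro!: mult_left_mono)
    qed (use der that in \<open>auto simp: has_vector_derivative_def\<close>)
    then show ?thesis using that by simp
  qed
  show ?thesis
    unfolding abs_continuous_fun_def
  proof (intro allI impI, rule exI, intro conjI allI impI)
    fix e :: real and I :: "(real \<times> real) set"
    assume e: "0 < e" and I: "finite I" "\<forall>(x, y)\<in>I. a \<le> x \<and> x \<le> y \<and> y \<le> b"
      and s: "(\<Sum>(x, y)\<in>I. y - x) < e / A"
    have "(\<Sum>(x, y)\<in>I. \<bar>f y - f x\<bar>) \<le> (\<Sum>(x, y)\<in>I. A * (y - x))"
      using I(2) lip by (intro sum_mono) auto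
    also have "\<dots> = A * (\<Sum>(x, y)\<in>I. y - x)" by (simp add: sum_distrib_left case_prod_unfold)
    also have "\<dots> < e" using s A(1) by (simp add: field_simps)
    finally show "(\<Sum>(x, y)\<in>I. \<bar>f y - f x\<bar>) < e" .
  qed (use A(1) in auto)
qed

text \<open>Caratheodory solutions include classical ones. The assumption \<open>antiper\<close> on
  \<open>w'\<close> supplies both the equation and the antiperiodicity of the derivative.\<close>

lemma beta_ant_le:
  assumes T: "0 < T" and p: "1 \<le> p" and a: "continuous_on {0..T} a" "\<And>t. t \<in> {0..T} \<Longrightarrow> 0 \<le> a t"
    and per: "\<And>t. a (t + T) = a t"
    and w: "antiper T w w'" "antiper T w' (\<lambda>t. - a t * w t)" "\<exists>t\<in>{0..T}. w t \<noteq> 0"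
  shows "beta_ant p T \<le> Lp_norm p T a"
proof -
  have "antiperiodic_solution T a w"
    unfolding antiperiodic_solution_def
  proof (intro exI[of _ w'] conjI ballI)
    show "abs_continuous_fun 0 T w'"
      by (rule C1_abs_continuous) (use w(2) in \<open>auto simp: antiper_def\<close>)
    show "AE t in lebesgue_on {0..T}. \<exists>u''. (w' has_real_derivative u'') (at t within {0..T}) \<and> u'' + a t * w t = 0"
      by (rule AE_I2, rule exI[of _ "- a _ * w _"])
        (use w(2) in \<open>auto simp: antiper_def has_real_derivative_iff_has_vector_derivative\<close>)
  qed (use w in \<open>auto simp: antiper_def has_real_derivative_iff_has_vector_derivative\<close>)
  then have "a \<in> antiperiodic_coeffs p T"
    unfolding antiperiodic_coeffs_def using per w(3) p a(1) by (auto intro: continuous_in_Lp_space)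
  moreover have "bdd_below ((\<lambda>a. Lp_norm p T (\<lambda>t. max (a t) 0)) ` antiperiodic_coeffs p T)"
    by (rule bdd_belowI2[of _ 0]) (rule Lp_norm_nonneg[OF T])
  ultimately have "beta_ant p T \<le> Lp_norm p T (\<lambda>t. max (a t) 0)"
    unfolding beta_ant_def by (intro cINF_lower)
  also have "\<dots> \<le> Lp_norm p T a"
    by (rule Lp_norm_mono[OF T p]) (use a in \<open>auto intro!: continuous_intros\<close>)
  finally show ?thesis .
qed


section \<open>Scalar coercivity\<close>

lemma energy_zero_imp_zero:
  fixes v :: "real \<Rightarrow> real"
  assumes "antiper T v v'" "\<And>t. t \<in> {0..T} \<Longrightarrow> v' t = 0" "t \<in> {0..T}"
  shows "v t = 0"
proof -
  have "energy T v' = integral {0..T} (\<lambda>t. 0)"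
    unfolding energy_def by (rule integral_cong) (use assms(2) in simp)
  then show ?thesis using real_antiper_sup_bound[OF assms(1,3)] by simp
qed

lemma continuous_integral_zero:
  fixes f :: "real \<Rightarrow> real"
  assumes "a < b" "continuous_on {a..b} f" "\<And>x. x \<in> {a..b} \<Longrightarrow> 0 \<le> f x" "integral {a..b} f = 0"
    "x \<in> {a..b}"
  shows "f x = 0"
  using integral_eq_0_iff[of a b f] assms by auto

text \<open>On the support of \<open>b\<close> the function \<open>w\<^sup>2\<close> cannot be equal to its maximum, so concentrating
  the mass of \<open>b\<close> near a maximum of \<open>w\<^sup>2\<close> gives a weight of smaller integral which is still
  critical. This is why the infimum is not attained for \<open>p = 1\<close>.\<close>

lemma weight_less_max:
  assumes T: "0 < T" and b: "continuous_on {0..T} b" "\<And>t. t \<in> {0..T} \<Longrightarrow> 0 \<le> b t"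
    and w: "antiper T w w'" "antiper T w' (\<lambda>t. - (b t / l) * w t)"
    and t0: "t0 \<in> {0..T}" "w t0 \<noteq> (0::real)" and M: "\<And>t. t \<in> {0..T} \<Longrightarrow> (w t)\<^sup>2 \<le> M"
  shows "weight T b w < M * integral {0..T} b"
proof (rule ccontr)
  assume "\<not> ?thesis"
  then have le: "M * integral {0..T} b \<le> weight T b w" by simp
  note c = antiper_continuous[OF w(1)]
  let ?f = "\<lambda>t. b t * M - b t * (w t)\<^sup>2"
  have f0: "0 \<le> ?f t" if "t \<in> {0..T}" for t
    using mult_left_mono[OF M[OF that] b(2)[OF that]] by simp
  have cf: "continuous_on {0..T} ?f" by (intro continuous_intros b c)
  have "integral {0..T} ?f = integral {0..T} (\<lambda>t. b t * M) - integral {0..T} (\<lambda>t. b t * (w t)\<^sup>2)"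
    by (intro integral_diff integrable_continuous_real continuous_intros b c)
  then have "integral {0..T} ?f \<le> 0" using le by (simp add: weight_def mult.commute)
  moreover have "0 \<le> integral {0..T} ?f"
    using f0 cf by (intro integral_nonneg integrable_continuous_real) auto
  ultimately have I0: "integral {0..T} ?f = 0" by simp
  have max: "(w t)\<^sup>2 = M" if "t \<in> {0..T}" "b t \<noteq> 0" for t
    using continuous_integral_zero[OF T cf f0 I0 that(1)] that(2) by simp
  have dw: "DERIV w t :> w' t" and dw': "DERIV w' t :> - (b t / l) * w t" if "0 < t" "t < T" for t
    using w that
    by (auto simp: antiper_def has_real_derivative_iff_has_vector_derivative at_within_Icc_at
        dest!: bspec[of _ _ t])
  \<comment> \<open>Where \<open>b\<close> is nonzero, \<open>w\<^sup>2\<close> is at its maximum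
    and its derivative \<open>2 w w'\<close> vanishes.\<close>
  have crit: "b t * w t * w' t = 0" if t: "0 < t" "t < T" for t
  proof (cases "b t = 0")
    case False
    then have eq: "(w t)\<^sup>2 = M" using max t by simp
    have "DERIV (\<lambda>t. (w t)\<^sup>2) t :> 2 * w t * w' t"
      using dw[OF t] by (auto intro!: derivative_eq_intros)
    then have "2 * w t * w' t = 0"
    proof (rule DERIV_local_max)
      show "0 < min t (T - t)" using t by simp
      show "\<forall>y. \<bar>t - y\<bar> < min t (T - t) \<longrightarrow> (w y)\<^sup>2 \<le> (w t)\<^sup>2"
        using M eq by (auto simp: abs_less_iff)
    qed
    then show ?thesis by simp
  qed simp
  have const: "(w' t)\<^sup>2 = (w' 0)\<^sup>2" if "t \<in> {0..T}" for t
  proof (rule DERIV_isconst2[OF T])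
    show "continuous_on {0..T} (\<lambda>t. (w' t)\<^sup>2)" by (intro continuous_intros c)
    fix x assume x: "0 < x" "x < T"
    have "DERIV (\<lambda>t. (w' t)\<^sup>2) x :> 2 * w' x * (- (b x / l) * w x)"
      using dw'[OF x] by (auto intro!: derivative_eq_intros)
    moreover have "2 * w' x * (- (b x / l) * w x) = - 2 / l * (b x * w x * w' x)" by simp
    ultimately show "DERIV (\<lambda>t. (w' t)\<^sup>2) x :> 0" by (simp only: crit[OF x]) simp
  qed (use that in auto)
  \<comment> \<open>By \<open>const\<close>, \<open>\<bar>w'\<bar>\<close> is constant. Were it
    nonzero, \<open>crit\<close> would give \<open>b w = 0\<close>, hence \<open>w'' = 0\<close> and
    \<open>w'\<close> constant, against its antiperiodicity.\<close>
  have "w' 0 = 0"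
  proof (rule ccontr)
    assume n0: "w' 0 \<noteq> 0"
    have "w' T = w' 0"
    proof (rule DERIV_isconst2[OF T c(2)])
      fix x assume x: "0 < x" "x < T"
      have "w' x \<noteq> 0" using const[of x] x n0 by auto
      then have "b x * w x = 0" using crit[OF x] by simp
      then have "- (b x / l) * w x = 0" by simp
      then show "DERIV w' x :> 0" using dw'[OF x] by metis
    qed (use T in auto)
    then show False using w(2) n0 by (simp add: antiper_def)
  qed
  then have "w' t = 0" if "t \<in> {0..T}" for t using const[OF that] by simp
  from energy_zero_imp_zero[OF w(1) this t0(1)] show False using t0(2) by simp
qed

text \<open>By \<open>weight_less_max\<close> the energy of \<open>w\<close> is less than the
  maximum of \<open>w\<^sup>2\<close> times the integral of \<open>b\<close>. A weight living only
  where \<open>w\<^sup>2\<close> is nearly maximal therefore reaches this energy with less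
  mass.\<close>

lemma better_weight:
  assumes T: "0 < T" and b: "continuous_on {0..T} b" "\<And>t. t \<in> {0..T} \<Longrightarrow> 0 \<le> b t"
    and l: "1 \<le> l" and w: "antiper T w w'" "antiper T w' (\<lambda>t. - (b t / l) * w t)"
    and nz: "\<exists>t\<in>{0..T}. w t \<noteq> (0::real)"
  obtains a where "continuous_on {0..T} a" "\<And>t. 0 \<le> a t" "a 0 = a T"
    "integral {0..T} a < integral {0..T} b" "energy T w' \<le> weight T a w" "0 < energy T w'"
proof -
  note c = antiper_continuous[OF w(1)]
  interpret nonneg_weight T b by unfold_locales (use T b in auto)
  have "energy T w' * l = weight T b w"
  proof -
    have "integral {0..T} (\<lambda>t. w' t * w' t) = integral {0..T} (\<lambda>t. (b t / l * w t) * w t)"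
      using antiper_by_parts[OF _ w(2,1)] T by simp
    also have "\<dots> = integral {0..T} (\<lambda>t. (1 / l) * (b t * (w t)\<^sup>2))"
      by (rule integral_cong) (simp add: power2_eq_square)
    also have "\<dots> = (1 / l) * weight T b w" unfolding weight_def by (rule integral_mult_right)
    finally show ?thesis using l by (simp add: energy_def power2_eq_square)
  qed
  moreover have E0: "0 \<le> energy T w'" by (rule energy_nonneg[OF c(2)])
  ultimately have Ew: "energy T w' \<le> weight T b w" using l by (metis mult_left_mono mult.right_neutral)
  have "continuous_on {0..T} (\<lambda>t. (w t)\<^sup>2)" by (intro continuous_intros c)
  from continuous_attains_sup[OF _ _ this] obtain t0 where t0: "t0 \<in> {0..T}"
    and max: "\<And>t. t \<in> {0..T} \<Longrightarrow> (w t)\<^sup>2 \<le> (w t0)\<^sup>2"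
    using T by auto
  have wt0: "w t0 \<noteq> 0" using nz max by force
  have Epos: "0 < energy T w'"
    using real_antiper_sup_bound[OF w(1) t0] wt0 E0 by (cases "energy T w' = 0") auto
  define I where "I = integral {0..T} b"
  have lt: "energy T w' < (w t0)\<^sup>2 * I"
    using weight_less_max[OF T b w t0 wt0 max] Ew by (simp add: I_def)
  have Ipos: "0 < I" using lt Epos wt0 by (smt (verit) mult_nonneg_nonpos zero_le_power2)
  \<comment> \<open>A weight supported where \<open>w\<^sup>2 \<ge> m\<close> reaches the energy
    once its mass is \<open>energy T w' / m\<close>, and the lower bound on \<open>m\<close> makes
    this mass less than \<open>I\<close>.\<close>
  obtain m where m: "energy T w' / I < m" "m < (w t0)\<^sup>2"
    using dense[of "energy T w' / I" "(w t0)\<^sup>2"] lt Ipos by (auto simp: field_simps)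
  have mpos: "0 < m" using m(1) Epos Ipos by (smt (verit) divide_pos_pos)
  \<comment> \<open>Truncation keeps the weight continuous, with equal values at \<open>0\<close>
    and \<open>T\<close> because \<open>w\<^sup>2\<close> has them; the factor \<open>s\<close>
    below fixes the total mass at \<open>energy T w' / m\<close>.\<close>
  define a0 where "a0 t = max ((w t)\<^sup>2 - m) 0" for t
  have ca0: "continuous_on {0..T} a0" unfolding a0_def by (intro continuous_intros c)
  define A where "A = integral {0..T} a0"
  have Apos: "0 < A"
  proof -
    have "0 \<le> A" unfolding A_def by (intro integral_nonneg integrable_continuous_real ca0) (simp add: a0_def)
    moreover have "A \<noteq> 0"
      using continuous_integral_zero[OF T ca0 _ _ t0] m(2) by (auto simp: A_def a0_def)
    ultimately show ?thesis by simp
  qed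
  define s where "s = energy T w' / (m * A)"
  have s: "0 < s" using Epos mpos Apos by (simp add: s_def)
  show thesis
  proof (rule that[of "\<lambda>t. s * a0 t"])
    show "continuous_on {0..T} (\<lambda>t. s * a0 t)" by (intro continuous_intros ca0)
    show "0 \<le> s * a0 t" for t using s by (simp add: a0_def)
    have "w T = - w 0" using w(1) by (simp add: antiper_def)
    then show "s * a0 0 = s * a0 T" by (simp add: a0_def)
    have "integral {0..T} (\<lambda>t. s * a0 t) = s * A" by (simp add: A_def)
    also have "\<dots> < I" using m(1) mpos Ipos Apos by (simp add: s_def field_simps)
    finally show "integral {0..T} (\<lambda>t. s * a0 t) < integral {0..T} b" by (simp add: I_def)
    have "energy T w' = integral {0..T} (\<lambda>t. s * m * a0 t)"
      using mpos Apos by (simp add: A_def[symmetric] s_def)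
    also have "\<dots> \<le> integral {0..T} (\<lambda>t. s * a0 t * (w t)\<^sup>2)"
    proof (rule integral_le)
      show "s * m * a0 t \<le> s * a0 t * (w t)\<^sup>2" for t
      proof (cases "m \<le> (w t)\<^sup>2")
        case True
        then have "(s * a0 t) * m \<le> (s * a0 t) * (w t)\<^sup>2"
          using s by (intro mult_left_mono) (auto simp: a0_def)
        then show ?thesis by (simp add: mult_ac)
      qed (simp add: a0_def)
    qed (intro integrable_continuous_real continuous_intros ca0 c)+
    finally show "energy T w' \<le> weight T (\<lambda>t. s * a0 t) w" by (simp add: weight_def)
    show "0 < energy T w'" by (rule Epos)
  qed
qed

text \<open>Admissible coefficients are periodic on the whole line, while the weights here are
  constructed on one period. Since \<open>frac\<close> sends the endpoint \<open>T\<close> to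
  \<open>0\<close>, the end values must agree.\<close>

lemma periodic_extension:
  fixes a :: "real \<Rightarrow> 'a"
  assumes T: "0 < T" and a: "a 0 = a T"
  obtains a' where "\<And>t. a' (t + T) = a' t" "\<And>t. t \<in> {0..T} \<Longrightarrow> a' t = a t"
proof
  define a' where "a' t = a (T * frac (t / T))" for t
  show "a' (t + T) = a' t" for t
    using T by (simp add: a'_def add_divide_distrib frac_1_eq)
  show "a' t = a t" if "t \<in> {0..T}" for t
  proof (cases "t = T")
    case True
    then show ?thesis using T a by (simp add: a'_def)
  next
    case False
    then have "frac (t / T) = t / T" using that T by (subst frac_eq) (auto simp: field_simps)
    then show ?thesis using T by (simp add: a'_def)
  qed
qed

text \<open>The eigenfunction belongs to the weight \<open>a / l\<close>, and
  \<open>l \<ge> 1\<close> means that the division does not increase the norm. The eigenfunction is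
  returned too, as raw material for \<open>better_weight\<close>.\<close>

lemma noncoercive_beta_le:
  assumes T: "0 < T" and p: "1 \<le> p" and a: "continuous_on {0..T} a" "\<And>t. t \<in> {0..T} \<Longrightarrow> 0 \<le> a t"
    and per: "a 0 = a T"
    and H: "\<And>c. 0 < c \<Longrightarrow> \<exists>v v'. antiper T v v' \<and> energy T v' - weight T a v < c * energy T v'"
  obtains l w w' where "beta_ant p T \<le> Lp_norm p T a" "1 \<le> l" "antiper T w w'"
    "antiper T w' (\<lambda>t. - (a t / l) * w t)" "\<exists>t\<in>{0..T}. w t \<noteq> 0"
proof -
  interpret nonneg_weight T a by unfold_locales (use T a in auto)
  obtain l w w' where l: "1 \<le> l" and w: "antiper T w w'" "antiper T w' (\<lambda>t. - (a t / l) * w t)"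
    "\<exists>t\<in>{0..T}. w t \<noteq> 0" by (rule eigenfunction_exists[OF H])
  obtain a' where a': "\<And>t. a' (t + T) = a' t" "\<And>t. t \<in> {0..T} \<Longrightarrow> a' t = a t"
    by (rule periodic_extension[OF T per]) (rule that)
  have ca': "continuous_on {0..T} (\<lambda>t. a' t / l)"
    by (rule continuous_on_eq[of _ "\<lambda>t. a t / l"]) (use a' a l in \<open>auto intro!: continuous_intros\<close>)
  have "beta_ant p T \<le> Lp_norm p T (\<lambda>t. a' t / l)"
  proof (rule beta_ant_le[OF T p ca' _ _ w(1) _ w(3)])
    show "antiper T w' (\<lambda>t. - (a' t / l) * w t)"
      by (rule antiper_deriv_cong[OF w(2)]) (simp add: a')
  qed (use a' a l in auto)
  also have "\<dots> \<le> Lp_norm p T a"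
  proof (rule Lp_norm_mono[OF T p ca' a(1)])
    fix t assume t: "t \<in> {0..T}"
    have "a t / l \<le> a t / 1" using a(2)[OF t] l by (intro divide_left_mono) auto
    then show "\<bar>a' t / l\<bar> \<le> \<bar>a t\<bar>" using a'(2)[OF t] a(2)[OF t] l by simp
  qed
  finally show thesis using that l w by blast
qed

lemma scalar_coercive:
  assumes T: "0 < T" and p: "1 \<le> p" and b: "continuous_on {0..T} b" "\<And>t. 0 \<le> b t" and per: "b 0 = b T"
    and lt: "1 < p \<Longrightarrow> Lp_norm p T b < beta_ant p T"
    and le: "p = 1 \<Longrightarrow> Lp_norm p T b \<le> beta_ant p T"
  shows "\<exists>c>0. \<forall>v v'. antiper T v v' \<longrightarrow> c * energy T v' \<le> energy T v' - weight T b v"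
proof (rule ccontr)
  assume "\<not> ?thesis"
  then have H: "\<exists>v v'. antiper T v v' \<and> energy T v' - weight T b v < c * energy T v'" if "0 < c" for c
    using that by (meson not_le)
  obtain l w w' where beta: "beta_ant p T \<le> Lp_norm p T b" and l: "1 \<le> l"
    and w: "antiper T w w'" "antiper T w' (\<lambda>t. - (b t / l) * w t)" "\<exists>t\<in>{0..T}. w t \<noteq> 0"
    by (rule noncoercive_beta_le[OF T p b per H])
  show False
  proof (cases "p = 1")
    case False
    then have "1 < p" using p by (simp add: order_less_le)
    then show ?thesis using lt beta by simp
  next
    case True
    \<comment> \<open>Equality is allowed for this exponent, so the bound on \<open>beta_ant\<close>
      is applied again, to a weight of smaller integral for which \<open>w\<close> itself refutes
      coercivity with every constant.\<close>
    obtain a where a: "continuous_on {0..T} a" "\<And>t. 0 \<le> a t" "a 0 = a T"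
      and ab: "integral {0..T} a < integral {0..T} b"
      and E: "energy T w' \<le> weight T a w" "0 < energy T w'"
      by (rule better_weight[OF T b l w]) (rule that)
    have "beta_ant 1 T \<le> Lp_norm 1 T a"
    proof (rule noncoercive_beta_le[OF T order_refl a])
      fix c :: real assume "0 < c"
      then have "0 < c * energy T w'" using E(2) by simp
      then show "\<exists>v v'. antiper T v v' \<and> energy T v' - weight T a v < c * energy T v'"
        using w(1) E(1) by (intro exI[of _ w] exI[of _ w']) simp
    qed
    also have "\<dots> = integral {0..T} a" using a by (intro Lp_norm_one) auto
    also have "\<dots> < integral {0..T} b" by (rule ab)
    also have "\<dots> = Lp_norm 1 T b" using b by (intro Lp_norm_one[symmetric]) auto
    finally show False using le True by simp
  qed
qed


section \<open>Boundedness from coercivity\<close>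

lemma matrix_vector_bounded_bilinear:
  "bounded_bilinear (\<lambda>(A :: real^'n^'m) x. A *v x)"
  by (rule iffD1[OF bilinear_conv_bounded_bilinear])
    (auto simp: bilinear_def linear_iff matrix_vector_mult_add_rdistrib matrix_vector_right_distrib
      scaleR_matrix_vector_assoc matrix_vector_mult_scaleR)

lemmas continuous_on_matrix_vector =
  bounded_bilinear.continuous_on[OF matrix_vector_bounded_bilinear]

lemma has_vector_derivative_matrix_vector:
  fixes A :: "real \<Rightarrow> real^'n^'m"
  assumes "(A has_vector_derivative A') (at t within S)"
  shows "((\<lambda>t. A t *v z) has_vector_derivative A' *v z) (at t within S)"
  by (rule bounded_linear.has_vector_derivative[OF
        bounded_bilinear.bounded_linear_left[OF matrix_vector_bounded_bilinear] assms])

lemma has_vector_derivative_inner: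
  fixes f g :: "real \<Rightarrow> 'a::real_inner"
  assumes "(f has_vector_derivative f') (at t within S)" "(g has_vector_derivative g') (at t within S)"
  shows "((\<lambda>t. f t \<bullet> g t) has_vector_derivative f t \<bullet> g' + f' \<bullet> g t) (at t within S)"
  by (rule bounded_bilinear.has_vector_derivative[OF bounded_bilinear_inner assms])

section \<open>Solutions and their conserved Wronskian\<close>

definition solves :: "(real \<Rightarrow> real^'n^'n) \<Rightarrow> (real \<Rightarrow> real^'n) \<Rightarrow> (real \<Rightarrow> real^'n) \<Rightarrow> bool" where
  "solves Q u u' \<longleftrightarrow> (\<forall>t. (u has_vector_derivative u' t) (at t) \<and>
     (u' has_vector_derivative - (Q t *v u t)) (at t))"

definition qform :: "real \<Rightarrow> (real \<Rightarrow> real^'n^'n) \<Rightarrow> (real \<Rightarrow> real^'n) \<Rightarrow> (real \<Rightarrow> real^'n) \<Rightarrow> real" where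
  "qform T Q v v' = integral {0..T} (\<lambda>t. (norm (v' t))\<^sup>2 - (Q t *v v t) \<bullet> v t)"

locale periodic_system =
  fixes T :: real and Q :: "real \<Rightarrow> real^'n^'n"
  assumes T: "0 < T" and Lambda: "Q \<in> Lambda T"
begin

lemma contQ: "continuous_on S Q"
proof -
  have "continuous_on UNIV (\<lambda>t. \<chi> i j. Q t $ i $ j)"
    using Lambda unfolding Lambda_def by (intro continuous_on_vec_lambda) auto
  then show ?thesis using continuous_on_subset by (fastforce simp: vec_nth_inverse)
qed

lemma symQ: "(Q t *v x) \<bullet> y = x \<bullet> (Q t *v y)"
proof -
  have "transpose (Q t) = Q t" using Lambda by (simp add: Lambda_def)
  then show ?thesis by (metis dot_lmul_matrix transpose_matrix_vector)
qed

lemma Q_nonneg: "0 \<le> integral {0..T} (\<lambda>t. (Q t *v k) \<bullet> k)"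
  using Lambda by (simp add: Lambda_def)

lemma Q_period: "Q (t + T) = Q t"
  using Lambda by (simp add: Lambda_def vec_eq_iff)

lemma Q_int_period: "Q (t + of_int k * T) = Q t"
proof (induction k rule: int_induct[of _ 0])
  case (step1 i)
  then show ?case using Q_period[of "t + of_int i * T"] by (simp add: algebra_simps)
next
  case (step2 i)
  then show ?case using Q_period[of "t + of_int (i - 1) * T"] by (simp add: algebra_simps)
qed simp

lemma Q_kernel:
  assumes "\<And>t. Q t *v z = 0"
  shows "z = 0"
proof -
  have "system_solution Q (\<lambda>t. z)"
    unfolding system_solution_def using assms by (intro exI[of _ "\<lambda>_. 0"]) auto
  then show ?thesis using Lambda by (auto simp: Lambda_def)
qed

lemma solves_continuous:
  assumes "solves Q u u'"
  shows "continuous_on S u" "continuous_on S u'"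
  using assms by (auto simp: solves_def intro!: has_vector_derivative_imp_continuous_on
      intro: has_vector_derivative_at_within)

lemma solves_shift:
  assumes "solves Q u u'"
  shows "solves Q (\<lambda>t. u (t + of_int k * T)) (\<lambda>t. u' (t + of_int k * T))"
proof -
  have sh: "((\<lambda>t. f (t + c)) has_vector_derivative d) (at t)"
    if "(f has_vector_derivative d) (at (t + c))" for f :: "real \<Rightarrow> real^'n" and c d t
  proof -
    have "((\<lambda>t. t + c) has_vector_derivative 1) (at t)" by (auto intro!: derivative_eq_intros)
    from vector_diff_chain_at[OF this that] show ?thesis by (simp add: o_def)
  qed
  show ?thesis
    unfolding solves_def
  proof (intro allI conjI)
    fix t
    have "(u has_vector_derivative u' (t + of_int k * T)) (at (t + of_int k * T))"
      "(u' has_vector_derivative - (Q t *v u (t + of_int k * T))) (at (t + of_int k * T))"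
      using assms Q_int_period[of t k] unfolding solves_def by metis+
    then show "((\<lambda>t. u (t + of_int k * T)) has_vector_derivative u' (t + of_int k * T)) (at t)"
      "((\<lambda>t. u' (t + of_int k * T)) has_vector_derivative - (Q t *v u (t + of_int k * T))) (at t)"
      by - (rule sh, assumption)+
  qed
qed

text \<open>The Wronskian of \<open>u\<close> and its translate by one period.\<close>
definition invariant :: "(real \<Rightarrow> real^'n) \<Rightarrow> (real \<Rightarrow> real^'n) \<Rightarrow> real \<Rightarrow> real" where
  "invariant u u' t = u' t \<bullet> u (t + T) - u t \<bullet> u' (t + T)"

text \<open>Periodicity of \<open>Q\<close> makes the translate a solution of the same system; in
  the derivative the terms in \<open>Q\<close> cancel by symmetry.\<close>

lemma invariant_constant:
  assumes u: "solves Q u u'"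
  shows "invariant u u' s = invariant u u' t"
proof -
  have v: "solves Q (\<lambda>t. u (t + T)) (\<lambda>t. u' (t + T))" using solves_shift[OF u, of 1] by simp
  have "(invariant u u' has_vector_derivative 0) (at t)" for t
  proof -
    have "((\<lambda>t. u' t \<bullet> u (t + T) - u t \<bullet> u' (t + T)) has_vector_derivative
        (u' t \<bullet> u' (t + T) + - (Q t *v u t) \<bullet> u (t + T))
        - (u t \<bullet> - (Q t *v u (t + T)) + u' t \<bullet> u' (t + T))) (at t)"
      using u v unfolding solves_def
      by (intro has_vector_derivative_diff has_vector_derivative_inner) auto
    then show ?thesis by (simp add: invariant_def[abs_def] symQ)
  qed
  then show ?thesis
    using has_derivative_zero_unique[of UNIV "invariant u u'" s t]
    by (auto simp: has_vector_derivative_def)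
qed

text \<open>With \<open>z = u 0 + u T\<close>, integrate \<open>u'' + Q u = 0\<close> against \<open>z - u\<close>, which exchanges the two
  boundary values of \<open>u\<close>, and complete the square: \<open>u - z / 2\<close> is antiperiodic.\<close>

lemma invariant_lower_bound:
  assumes u: "solves Q u u'"
    and coer: "\<And>v v'. antiper T v v' \<Longrightarrow> c * integral {0..T} (\<lambda>t. (norm (v' t))\<^sup>2) \<le> qform T Q v v'"
  shows "c * integral {0..T} (\<lambda>t. (norm (u' t))\<^sup>2) \<le> invariant u u' 0"
proof -
  define z where "z = u 0 + u T"
  let ?h = "z /\<^sub>R 2"
  note cu = solves_continuous[OF u, of "{0..T}"]
  note ci = continuous_intros continuous_on_matrix_vector contQ cu
  have d: "(u has_vector_derivative u' t) (at t within {0..T})"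
    "(u' has_vector_derivative - (Q t *v u t)) (at t within {0..T})" for t
    using u by (auto simp: solves_def intro: has_vector_derivative_at_within)
  \<comment> \<open>Nothing is known about \<open>u' 0 + u' T\<close>, which is why
    \<open>antiper\<close> constrains the end values of the function but not those of its
    derivative.\<close>
  have "antiper T (\<lambda>t. u t - ?h) u'"
    unfolding antiper_def
  proof (intro conjI ballI)
    show "((\<lambda>t. u t - ?h) has_vector_derivative u' t) (at t within {0..T})" for t
      using has_vector_derivative_diff[OF d(1)[of t] has_vector_derivative_const[of ?h]] by simp
    have "?h + ?h = z" by (simp flip: scaleR_left.add)
    then show "u 0 - ?h + (u T - ?h) = 0" by (simp add: z_def algebra_simps)
  qed (rule cu)
  then have 1: "c * integral {0..T} (\<lambda>t. (norm (u' t))\<^sup>2) \<le> qform T Q (\<lambda>t. u t - ?h) u'" by (rule coer)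
  have "((\<lambda>t. u' t \<bullet> (- u' t) + - (Q t *v u t) \<bullet> (z - u t)) has_integral
      u' T \<bullet> (z - u T) - u' 0 \<bullet> (z - u 0)) {0..T}"
  proof (rule fundamental_theorem_of_calculus)
    show "((\<lambda>t. u' t \<bullet> (z - u t)) has_vector_derivative u' t \<bullet> (- u' t) + - (Q t *v u t) \<bullet> (z - u t))
        (at t within {0..T})" for t
      using has_vector_derivative_diff[OF has_vector_derivative_const[of z] d(1)[of t]]
      by (intro has_vector_derivative_inner d) simp
  qed (use T in auto)
  moreover have "u' T \<bullet> (z - u T) - u' 0 \<bullet> (z - u 0) = - invariant u u' 0"
    by (simp add: z_def invariant_def inner_commute)
  ultimately have "invariant u u' 0 = - integral {0..T} (\<lambda>t. u' t \<bullet> (- u' t) + - (Q t *v u t) \<bullet> (z - u t))"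
    by (simp only: integral_unique minus_minus)
  also have "\<dots> = integral {0..T} (\<lambda>t. - (u' t \<bullet> (- u' t) + - (Q t *v u t) \<bullet> (z - u t)))"
    by (rule integral_neg[symmetric])
  also have "\<dots> = integral {0..T} (\<lambda>t. ((norm (u' t))\<^sup>2 - (Q t *v (u t - ?h)) \<bullet> (u t - ?h))
       + (1 / 4) * ((Q t *v z) \<bullet> z))"
  proof (rule integral_cong)
    fix t
    have e: "(Q t *v (u t - ?h)) \<bullet> (u t - ?h) =
       (Q t *v u t) \<bullet> u t - (Q t *v u t) \<bullet> z + ((Q t *v z) \<bullet> z) / 4"
      using symQ[of t z "u t"]
      by (simp add: matrix_vector_mult_diff_distrib matrix_vector_mult_scaleR inner_diff_left
          inner_diff_right inner_commute field_simps)
    show "- (u' t \<bullet> (- u' t) + - (Q t *v u t) \<bullet> (z - u t)) =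
       ((norm (u' t))\<^sup>2 - (Q t *v (u t - ?h)) \<bullet> (u t - ?h)) + (1 / 4) * ((Q t *v z) \<bullet> z)"
      unfolding e by (simp add: power2_norm_eq_inner inner_diff_right)
  qed
  also have "\<dots> = qform T Q (\<lambda>t. u t - ?h) u' + integral {0..T} (\<lambda>t. (1 / 4) * ((Q t *v z) \<bullet> z))"
    unfolding qform_def by (intro integral_add integrable_continuous_real ci)
  also have "integral {0..T} (\<lambda>t. (1 / 4) * ((Q t *v z) \<bullet> z)) = (1 / 4) * integral {0..T} (\<lambda>t. (Q t *v z) \<bullet> z)"
    by (rule integral_mult_right)
  finally show ?thesis using 1 Q_nonneg[of z] by simp
qed

text \<open>Adding the mean of \<open>F\<close> to \<open>- F\<close> gives \<open>M\<close>
  integral zero over the period. Hence \<open>\<Phi>\<close> vanishes at both ends, and testing an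
  equation against it leaves no boundary term in \<open>u'\<close>.\<close>

lemma double_primitive:
  obtains M \<Phi> where "\<And>t. t \<in> {0..T} \<Longrightarrow> (\<Phi> has_vector_derivative M t) (at t within {0..T})"
    "\<And>t. t \<in> {0..T} \<Longrightarrow> (M has_vector_derivative - Q t) (at t within {0..T})"
    "\<Phi> 0 = 0" "\<Phi> T = 0"
proof -
  define F where "F t = integral {0..t} Q" for t
  have F: "(F has_vector_derivative Q t) (at t within {0..T})" if "t \<in> {0..T}" for t
    unfolding F_def[abs_def] using integral_has_vector_derivative[OF contQ that] .
  have cF: "continuous_on {0..T} F" using F by (rule has_vector_derivative_imp_continuous_on)
  define M where "M t = (1 / T) *\<^sub>R integral {0..T} F - F t" for t
  have cM: "continuous_on {0..T} M" unfolding M_def by (intro continuous_intros cF)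
  show thesis
  proof (rule that[of "\<lambda>t. integral {0..t} M" M])
    show "((\<lambda>t. integral {0..t} M) has_vector_derivative M t) (at t within {0..T})" if "t \<in> {0..T}" for t
      by (rule integral_has_vector_derivative[OF cM that])
    show "(M has_vector_derivative - Q t) (at t within {0..T})" if "t \<in> {0..T}" for t
      using has_vector_derivative_diff[OF has_vector_derivative_const[of "(1 / T) *\<^sub>R integral {0..T} F"] F[OF that]]
      by (simp add: M_def[abs_def])
    have "integral {0..T} M = integral {0..T} (\<lambda>t. (1 / T) *\<^sub>R integral {0..T} F) - integral {0..T} F"
      unfolding M_def by (intro integral_diff integrable_continuous_real continuous_intros cF)
    then show "integral {0..T} M = 0" using T by simp
  qed auto
qed

lemma continuous_bound:
  fixes f :: "real \<Rightarrow> 'a::real_normed_vector"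
  assumes "continuous_on {0..T} f"
  obtains K where "0 < K" "\<And>t. t \<in> {0..T} \<Longrightarrow> norm (f t) \<le> K"
proof -
  have "bounded (f ` {0..T})" using assms by (intro compact_imp_bounded compact_continuous_image) auto
  then show thesis using that by (auto simp: bounded_pos)
qed

text \<open>A solution cannot be nearly constant: test the equation against \<open>\<Phi> z\<close> with \<open>z = u 0\<close>. For \<open>u\<close>
  close to \<open>z\<close> this gives nearly \<open>\<integral> \<langle>Q z, \<Phi> z\<rangle> = \<integral> \<bar>\<Phi>' z\<bar>\<^sup>2\<close>, which is positive definite in \<open>z\<close> because
  no nonzero constant is a solution.\<close>

lemma value_bound:
  obtains C where "0 < C"
    "\<And>u u'. solves Q u u' \<Longrightarrow> (norm (u 0))\<^sup>2 \<le> C * integral {0..T} (\<lambda>t. (norm (u' t))\<^sup>2)"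
proof -
  obtain M \<Phi> where d\<Phi>: "\<And>t. t \<in> {0..T} \<Longrightarrow> (\<Phi> has_vector_derivative M t) (at t within {0..T})"
    and dM: "\<And>t. t \<in> {0..T} \<Longrightarrow> (M has_vector_derivative - Q t) (at t within {0..T})"
    and \<Phi>0: "\<Phi> 0 = 0" and \<Phi>T: "\<Phi> T = 0"
    by (rule double_primitive) (rule that)
  have c\<Phi>: "continuous_on {0..T} \<Phi>" using d\<Phi> by (rule has_vector_derivative_imp_continuous_on)
  have cM: "continuous_on {0..T} M" using dM by (rule has_vector_derivative_imp_continuous_on)
  define G where "G z = integral {0..T} (\<lambda>t. (norm (M t *v z))\<^sup>2)" for z
  have dz: "((\<lambda>t. A t *v z) has_vector_derivative A' *v z) (at t within {0..T})"
    if "(A has_vector_derivative A') (at t within {0..T})" for A :: "real \<Rightarrow> real^'n^'n" and A' t z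
    using that by (rule has_vector_derivative_matrix_vector)
  have neg: "(- A) *v z = - (A *v z)" for A :: "real^'n^'n" and z
    by (simp add: vec_eq_iff matrix_vector_mult_def sum_negf)
  have Gz: "G z = integral {0..T} (\<lambda>t. (Q t *v z) \<bullet> (\<Phi> t *v z))" for z
  proof -
    note ci = continuous_intros continuous_on_matrix_vector contQ c\<Phi> cM
    have "((\<lambda>t. (M t *v z) \<bullet> (M t *v z) + (- Q t *v z) \<bullet> (\<Phi> t *v z)) has_integral
       (M T *v z) \<bullet> (\<Phi> T *v z) - (M 0 *v z) \<bullet> (\<Phi> 0 *v z)) {0..T}"
      by (rule fundamental_theorem_of_calculus)
        (use T in \<open>auto intro!: has_vector_derivative_inner dz d\<Phi> dM\<close>)
    then have "integral {0..T} (\<lambda>t. (norm (M t *v z))\<^sup>2 - (Q t *v z) \<bullet> (\<Phi> t *v z)) = 0"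
      by (simp add: \<Phi>0 \<Phi>T neg power2_norm_eq_inner integral_unique)
    moreover have "integral {0..T} (\<lambda>t. (norm (M t *v z))\<^sup>2 - (Q t *v z) \<bullet> (\<Phi> t *v z))
       = G z - integral {0..T} (\<lambda>t. (Q t *v z) \<bullet> (\<Phi> t *v z))"
      unfolding G_def by (intro integral_diff integrable_continuous_real ci)
    ultimately show ?thesis by simp
  qed
  have Gpos: "0 < G z" if z: "z \<noteq> 0" for z
  proof -
    have c: "continuous_on {0..T} (\<lambda>t. (norm (M t *v z))\<^sup>2)"
      by (intro continuous_intros continuous_on_matrix_vector cM)
    have "0 \<le> G z" unfolding G_def using c by (intro integral_nonneg integrable_continuous_real) auto
    moreover have "G z \<noteq> 0"
    proof
      assume "G z = 0"
      then have M0: "M t *v z = 0" if "t \<in> {0..T}" for t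
        using integral_eq_0_iff[OF c T] that by (auto simp: G_def)
      have Q0: "Q t *v z = 0" if t: "t \<in> {0..T}" for t
      proof -
        have "((\<lambda>t. M t *v z) has_vector_derivative - Q t *v z) (at t within {0..T})"
          by (rule dz[OF dM[OF t]])
        moreover have "((\<lambda>t. M t *v z) has_vector_derivative 0) (at t within {0..T})"
          by (rule has_vector_derivative_transform[where f = "\<lambda>_. 0", OF t]) (use M0 t in auto)
        ultimately have "- Q t *v z = 0"
          using vector_derivative_unique_within_closed_interval[of 0 T t] T t by auto
        then show ?thesis by (simp add: neg)
      qed
      have "Q t *v z = 0" for t
      proof -
        have "t + of_int (- \<lfloor>t / T\<rfloor>) * T = T * frac (t / T)"
          using T by (simp add: frac_def field_simps)
        moreover have "T * frac (t / T) \<in> {0..T}"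
          using T frac_lt_1[of "t / T"] by (simp add: mult_left_le)
        ultimately show ?thesis using Q0 Q_int_period[of t "- \<lfloor>t / T\<rfloor>"] by metis
      qed
      then show False using Q_kernel z by blast
    qed
    ultimately show ?thesis by simp
  qed
  \<comment> \<open>\<open>G\<close> is a continuous quadratic form, so its minimum on the unit
    sphere, positive by \<open>Gpos\<close>, serves as \<open>m\<close>.\<close>
  obtain m where m: "0 < m" "\<And>z. m * (norm z)\<^sup>2 \<le> G z"
  proof -
    have "continuous_on UNIV G"
    proof -
      have "continuous_on (UNIV \<times> cbox 0 T) (\<lambda>(z, t). (norm (M t *v z))\<^sup>2)"
        unfolding case_prod_unfold
        by (intro continuous_intros continuous_on_matrix_vector continuous_on_compose2[OF cM]) auto
      then show ?thesis unfolding G_def using integral_continuous_on_param by fastforce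
    qed
    then have "continuous_on (sphere 0 1) G" using continuous_on_subset by blast
    moreover have "sphere (0 :: real^'n) 1 \<noteq> {}" by simp
    ultimately obtain z0 where z0: "z0 \<in> sphere 0 1" "\<And>z. z \<in> sphere 0 1 \<Longrightarrow> G z0 \<le> G z"
      using continuous_attains_inf[of "sphere 0 1" G] by auto
    have "G z0 * (norm z)\<^sup>2 \<le> G z" for z
    proof (cases "z = 0")
      case False
      have "G z0 \<le> G (z /\<^sub>R norm z)" by (rule z0(2)) (use False in simp)
      also have "\<dots> = (inverse (norm z))\<^sup>2 * G z"
        unfolding G_def
        by (simp add: matrix_vector_mult_scaleR power_mult_distrib flip: integral_mult_right)
      finally show ?thesis using False by (simp add: field_simps)
    qed (simp add: G_def)
    moreover have "z0 \<noteq> 0" using z0(1) by auto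
    then have "0 < G z0" by (rule Gpos)
    ultimately show ?thesis using that by blast
  qed
  obtain K where K: "0 < K" "\<And>A x. norm (A *v x) \<le> norm (A :: real^'n^'n) * norm (x :: real^'n) * K"
    using bounded_bilinear.pos_bounded[OF matrix_vector_bounded_bilinear] by metis
  obtain KQ where KQ: "0 < KQ" "\<And>t. t \<in> {0..T} \<Longrightarrow> norm (Q t) \<le> KQ" by (rule continuous_bound[OF contQ]) (rule that)
  obtain KM where KM: "0 < KM" "\<And>t. t \<in> {0..T} \<Longrightarrow> norm (M t) \<le> KM" by (rule continuous_bound[OF cM]) (rule that)
  obtain KP where KP: "0 < KP" "\<And>t. t \<in> {0..T} \<Longrightarrow> norm (\<Phi> t) \<le> KP" by (rule continuous_bound[OF c\<Phi>]) (rule that)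
  define L where "L = max (KQ * K * (KP * K)) (KM * K)"
  have L: "0 < L" "KQ * K * (KP * K) \<le> L" "KM * K \<le> L" using KM K by (auto simp: L_def less_max_iff_disj)
  \<comment> \<open>Read off from the final estimate, after half of
    \<open>m * (norm z)\<^sup>2\<close> has been absorbed on the left and the result divided by
    \<open>m\<close>.\<close>
  define C where "C = (4 * T * L\<^sup>2 / m) * (1 + T\<^sup>2) / m"
  show thesis
  proof (rule that[of C])
    show "0 < C" unfolding C_def using T L m by (intro divide_pos_pos mult_pos_pos) (auto simp: add_pos_nonneg)
    fix u u' assume u: "solves Q u u'"
    note cu = solves_continuous[OF u, of "{0..T}"]
    note ci = continuous_intros continuous_on_matrix_vector contQ c\<Phi> cM cu
    define z where "z = u 0"
    let ?N = "integral {0..T} (\<lambda>t. (norm (u' t))\<^sup>2)"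
    have du: "(u has_vector_derivative u' t) (at t within {0..T})"
      "(u' has_vector_derivative - (Q t *v u t)) (at t within {0..T})" for t
      using u by (auto simp: solves_def intro: has_vector_derivative_at_within)
    have N0: "0 \<le> ?N" by (intro integral_nonneg integrable_continuous_real ci) auto
    have uz: "(norm (z - u t))\<^sup>2 \<le> T * ?N" if t: "t \<in> {0..T}" for t
    proof -
      have "(norm (u 0 - u t))\<^sup>2 \<le> \<bar>0 - t\<bar> * ?N"
        by (rule increment_bound) (use du cu t in auto)
      also have "\<dots> \<le> T * ?N" using t N0 by (intro mult_right_mono) auto
      finally show ?thesis by (simp add: z_def)
    qed
    have "((\<lambda>t. u' t \<bullet> (M t *v z) + - (Q t *v u t) \<bullet> (\<Phi> t *v z)) has_integral
       u' T \<bullet> (\<Phi> T *v z) - u' 0 \<bullet> (\<Phi> 0 *v z)) {0..T}"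
    proof (rule fundamental_theorem_of_calculus)
      show "((\<lambda>t. u' t \<bullet> (\<Phi> t *v z)) has_vector_derivative
          u' t \<bullet> (M t *v z) + - (Q t *v u t) \<bullet> (\<Phi> t *v z)) (at t within {0..T})"
        if "t \<in> {0..T}" for t
        by (intro has_vector_derivative_inner dz d\<Phi> du that)
    qed (use T in auto)
    then have "integral {0..T} (\<lambda>t. u' t \<bullet> (M t *v z) + - (Q t *v u t) \<bullet> (\<Phi> t *v z)) = 0"
      by (simp add: \<Phi>0 \<Phi>T integral_unique)
    \<comment> \<open>A vanishing integral is added so that \<open>Q z\<close> and
      \<open>Q u\<close> combine into \<open>Q (z - u)\<close>, which the energy of \<open>u\<close>
      controls.\<close>
    then have "G z = integral {0..T} (\<lambda>t. (Q t *v z) \<bullet> (\<Phi> t *v z))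
       + integral {0..T} (\<lambda>t. u' t \<bullet> (M t *v z) + - (Q t *v u t) \<bullet> (\<Phi> t *v z))"
      using Gz by simp
    also have "\<dots> = integral {0..T} (\<lambda>t. (Q t *v z) \<bullet> (\<Phi> t *v z)
       + (u' t \<bullet> (M t *v z) + - (Q t *v u t) \<bullet> (\<Phi> t *v z)))"
      by (rule integral_add[symmetric]) (intro integrable_continuous_real ci)+
    also have "\<dots> \<le> integral {0..T} (\<lambda>t. m / (2 * T) * (norm z)\<^sup>2
       + (2 * T * L\<^sup>2 / m) * (norm (u' t))\<^sup>2 + (2 * T * L\<^sup>2 / m) * (T * ?N))"
    proof (rule integral_le)
      fix t assume t: "t \<in> {0..T}"
      \<comment> \<open>The coefficient \<open>m / (4 * T)\<close> occurs for two terms, and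
        integration over the period turns it into \<open>m / 2\<close>, half of the lower bound for
        \<open>G\<close>.\<close>
      have young: "L * x * y \<le> m / (4 * T) * y\<^sup>2 + (2 * T * L\<^sup>2 / m) * x\<^sup>2" for x y :: real
      proof -
        have "0 \<le> (m * y - 2 * T * L * x)\<^sup>2 + 4 * T\<^sup>2 * L\<^sup>2 * x\<^sup>2" by simp
        then show ?thesis using m T by (simp add: field_simps power2_eq_square)
      qed
      have "(Q t *v z) \<bullet> (\<Phi> t *v z) + (u' t \<bullet> (M t *v z) + - (Q t *v u t) \<bullet> (\<Phi> t *v z))
         = (Q t *v (z - u t)) \<bullet> (\<Phi> t *v z) + u' t \<bullet> (M t *v z)"
        by (simp add: matrix_vector_mult_diff_distrib inner_diff_left)
      also have "\<dots> \<le> L * norm (z - u t) * norm z + L * norm (u' t) * norm z"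
      proof (rule add_mono)
        have "(Q t *v (z - u t)) \<bullet> (\<Phi> t *v z) \<le> norm (Q t *v (z - u t)) * norm (\<Phi> t *v z)"
          by (rule norm_cauchy_schwarz)
        also have "\<dots> \<le> (KQ * norm (z - u t) * K) * (KP * norm z * K)"
          using K KQ(2)[OF t] KP(2)[OF t] KQ(1) KP(1)
          by (intro mult_mono order.trans[OF K(2)]) auto
        also have "\<dots> = (KQ * K * (KP * K)) * (norm (z - u t) * norm z)" by simp
        also have "\<dots> \<le> L * (norm (z - u t) * norm z)" using L(2) by (intro mult_right_mono) auto
        finally show "(Q t *v (z - u t)) \<bullet> (\<Phi> t *v z) \<le> L * norm (z - u t) * norm z" by simp
        have "u' t \<bullet> (M t *v z) \<le> norm (u' t) * norm (M t *v z)" by (rule norm_cauchy_schwarz)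
        also have "\<dots> \<le> norm (u' t) * (KM * norm z * K)"
          using K KM(2)[OF t] KM(1) by (intro mult_mono order.trans[OF K(2)]) auto
        also have "\<dots> = (KM * K) * (norm (u' t) * norm z)" by simp
        also have "\<dots> \<le> L * (norm (u' t) * norm z)" using L(3) by (intro mult_right_mono) auto
        finally show "u' t \<bullet> (M t *v z) \<le> L * norm (u' t) * norm z" by simp
      qed
      also have "\<dots> \<le> (m / (4 * T) * (norm z)\<^sup>2 + (2 * T * L\<^sup>2 / m) * (norm (z - u t))\<^sup>2)
         + (m / (4 * T) * (norm z)\<^sup>2 + (2 * T * L\<^sup>2 / m) * (norm (u' t))\<^sup>2)"
        by (intro add_mono young)
      also have "(2 * T * L\<^sup>2 / m) * (norm (z - u t))\<^sup>2 \<le> (2 * T * L\<^sup>2 / m) * (T * ?N)"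
        using T m by (intro mult_left_mono uz t) auto
      finally show "(Q t *v z) \<bullet> (\<Phi> t *v z) + (u' t \<bullet> (M t *v z) + - (Q t *v u t) \<bullet> (\<Phi> t *v z))
        \<le> m / (2 * T) * (norm z)\<^sup>2 + (2 * T * L\<^sup>2 / m) * (norm (u' t))\<^sup>2 + (2 * T * L\<^sup>2 / m) * (T * ?N)"
        by (simp add: field_simps)
    qed (intro integrable_continuous_real ci)+
    also have "\<dots> = T * (m / (2 * T) * (norm z)\<^sup>2) + (2 * T * L\<^sup>2 / m) * ?N
       + T * ((2 * T * L\<^sup>2 / m) * (T * ?N))"
    proof (rule integral_unique, intro has_integral_add)
      show "((\<lambda>t. (2 * T * L\<^sup>2 / m) * (norm (u' t))\<^sup>2) has_integral (2 * T * L\<^sup>2 / m) * ?N) {0..T}"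
        by (intro has_integral_mult_right integrable_integral integrable_continuous_real ci)
      show "((\<lambda>t. c) has_integral T * c) {0..T}" for c :: real
        using has_integral_const_real[of c 0 T] T by simp
      then show "((\<lambda>t. c) has_integral T * c) {0..T}" for c :: real .
    qed
    also have "\<dots> = m / 2 * (norm z)\<^sup>2 + (2 * T * L\<^sup>2 / m) * (1 + T\<^sup>2) * ?N"
      using T m(1) by (simp add: power2_eq_square field_simps)
    finally have "m / 2 * (norm z)\<^sup>2 \<le> (2 * T * L\<^sup>2 / m) * (1 + T\<^sup>2) * ?N"
      using m(2)[of z] by simp
    then have "m * (norm z)\<^sup>2 \<le> (4 * T * L\<^sup>2 / m) * (1 + T\<^sup>2) * ?N" by simp
    then have "(norm z)\<^sup>2 \<le> (4 * T * L\<^sup>2 / m) * (1 + T\<^sup>2) * ?N / m"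
      using m(1) by (simp add: pos_le_divide_eq mult.commute)
    then show "(norm (u 0))\<^sup>2 \<le> C * ?N" by (simp add: C_def z_def)
  qed
qed

theorem coercive_imp_bounded:
  assumes u: "system_solution Q u" and c: "0 < c"
    and coer: "\<And>v v'. antiper T v v' \<Longrightarrow> c * integral {0..T} (\<lambda>t. (norm (v' t))\<^sup>2) \<le> qform T Q v v'"
  shows "bounded (range u)"
proof -
  obtain u' u'' where d: "\<And>t. (u has_vector_derivative u' t) (at t)"
    "\<And>t. (u' has_vector_derivative u'' t) (at t)" and eq: "\<And>t. u'' t + Q t *v u t = 0"
    using u unfolding system_solution_def by metis
  have "u'' t = - (Q t *v u t)" for t using eq[of t] by (simp add: eq_neg_iff_add_eq_0)
  then have u: "solves Q u u'" using d by (simp add: solves_def)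
  obtain C where C: "0 < C"
    "\<And>u u'. solves Q u u' \<Longrightarrow> (norm (u 0))\<^sup>2 \<le> C * integral {0..T} (\<lambda>t. (norm (u' t))\<^sup>2)"
    by (rule value_bound) (rule that)
  define E where "E = invariant u u' 0 / c"
  have "norm (u x) \<le> sqrt (C * E) + sqrt (T * E)" for x
  proof -
    define k where "k = \<lfloor>x / T\<rfloor>"
    define t where "t = x - of_int k * T"
    have t: "t \<in> {0..T}"
    proof -
      have "of_int k \<le> x / T" "x / T \<le> of_int k + 1" unfolding k_def by linarith+
      then show ?thesis using T by (simp add: t_def field_simps)
    qed
    let ?v = "\<lambda>t. u (t + of_int k * T)" and ?v' = "\<lambda>t. u' (t + of_int k * T)"
    let ?N = "integral {0..T} (\<lambda>t. (norm (?v' t))\<^sup>2)"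
    \<comment> \<open>As the translate solves the same system, \<open>c\<close> and \<open>C\<close>
      do not depend on \<open>k\<close>; conservation of the Wronskian makes \<open>E\<close> common
      to all periods.\<close>
    have v: "solves Q ?v ?v'" by (rule solves_shift[OF u])
    have "c * ?N \<le> invariant ?v ?v' 0" by (rule invariant_lower_bound[OF v coer])
    also have "\<dots> = invariant u u' (of_int k * T)" by (simp add: invariant_def add.commute)
    also have "\<dots> = invariant u u' 0" by (rule invariant_constant[OF u])
    finally have N: "?N \<le> E" using c by (simp add: E_def field_simps)
    have "(norm (?v t - ?v 0))\<^sup>2 \<le> \<bar>t - 0\<bar> * ?N"
      by (rule increment_bound)
        (use v t T solves_continuous[OF v] in \<open>auto simp: solves_def intro: has_vector_derivative_at_within\<close>)
    also have "\<dots> \<le> T * E"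
    proof (rule mult_mono)
      show "0 \<le> ?N" by (intro integral_nonneg integrable_continuous_real continuous_intros
            solves_continuous(2)[OF v]) auto
    qed (use t T N in auto)
    finally have 1: "norm (?v t - ?v 0) \<le> sqrt (T * E)" by (rule real_le_rsqrt)
    have "(norm (?v 0))\<^sup>2 \<le> C * ?N" by (rule C(2)[OF v])
    also have "\<dots> \<le> C * E" using N C(1) by simp
    finally have 2: "norm (?v 0) \<le> sqrt (C * E)" by (rule real_le_rsqrt)
    have "?v t = u x" by (simp add: t_def)
    then show ?thesis using 1 2 norm_triangle_sub[of "?v t" "?v 0"] by simp
  qed
  then show ?thesis by (auto simp: bounded_iff)
qed

end


section \<open>Stability\<close>

lemma antiper_component:
  assumes "antiper T v v'"
  shows "antiper T (\<lambda>t. v t $ i) (\<lambda>t. v' t $ i)"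
  unfolding antiper_def
proof (intro conjI ballI)
  show "v 0 $ i + v T $ i = 0"
    using assms by (simp add: antiper_def flip: vector_add_component)
qed (use assms in \<open>auto simp: antiper_def intro!: continuous_intros
      bounded_linear.has_vector_derivative[OF bounded_linear_vec_nth]\<close>)

lemma norm_power2_sum: "(norm (x :: real^'n))\<^sup>2 = (\<Sum>i\<in>UNIV. (x $ i)\<^sup>2)"
  unfolding power2_norm_eq_inner inner_vec_def by (simp add: power2_eq_square)

lemma energy_sum:
  assumes "continuous_on {0..T} v'"
  shows "integral {0..T} (\<lambda>t. (norm (v' t :: real^'n))\<^sup>2) = (\<Sum>i\<in>UNIV. energy T (\<lambda>t. v' t $ i))"
  unfolding norm_power2_sum energy_def
  by (intro integral_sum integrable_continuous_real continuous_intros assms) auto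

lemma diagonal_comparison:
  fixes P B :: "real^'n^'n"
  assumes diag: "\<And>i j. i \<noteq> j \<Longrightarrow> B $ i $ j = 0" and le: "loewner_le P B"
  shows "(P *v x) \<bullet> x \<le> (\<Sum>i\<in>UNIV. max (B $ i $ i) 0 * (x $ i)\<^sup>2)"
proof -
  have "0 \<le> ((B - P) *v x) \<bullet> x" using le by (simp add: loewner_le_def)
  then have "(P *v x) \<bullet> x \<le> (B *v x) \<bullet> x"
    by (simp add: matrix_vector_mult_diff_rdistrib inner_diff_left)
  also have "\<dots> = (\<Sum>i\<in>UNIV. B $ i $ i * (x $ i)\<^sup>2)"
  proof -
    have "(B *v x) $ i = B $ i $ i * x $ i" for i
    proof -
      have "(\<Sum>j\<in>UNIV. B $ i $ j * x $ j) = (\<Sum>j\<in>{i}. B $ i $ j * x $ j)"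
        by (rule sum.mono_neutral_right) (use diag in auto)
      then show ?thesis by (simp add: matrix_vector_mult_def)
    qed
    then show ?thesis by (simp add: inner_vec_def power2_eq_square mult.assoc)
  qed
  also have "\<dots> \<le> (\<Sum>i\<in>UNIV. max (B $ i $ i) 0 * (x $ i)\<^sup>2)"
    by (intro sum_mono mult_right_mono) auto
  finally show ?thesis .
qed

text \<open>A diagonal majorant decouples the components and the energy is the sum of their
  energies, so scalar coercivity with a common \<open>c\<close> can be added up.\<close>

lemma coercive_of_diagonal_bound:
  fixes P B :: "real \<Rightarrow> real^'n^'n"
  assumes P: "continuous_on {0..T} P"
    and diag: "\<And>t i j. i \<noteq> j \<Longrightarrow> B t $ i $ j = 0"
    and cB: "\<And>i. continuous_on {0..T} (\<lambda>t. B t $ i $ i)"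
    and le: "\<And>t. loewner_le (P t) (B t)"
    and c: "\<And>i v v'. antiper T v v' \<Longrightarrow>
      c * energy T v' \<le> energy T v' - weight T (\<lambda>t. max (B t $ i $ i) 0) v"
    and v: "antiper T v v'"
  shows "c * integral {0..T} (\<lambda>t. (norm (v' t))\<^sup>2) \<le> qform T P v v'"
proof -
  let ?b = "\<lambda>i t. max (B t $ i $ i) 0"
  note ci = continuous_intros continuous_on_matrix_vector P cB antiper_continuous[OF v]
  have "c * integral {0..T} (\<lambda>t. (norm (v' t))\<^sup>2) = (\<Sum>i\<in>UNIV. c * energy T (\<lambda>t. v' t $ i))"
    by (simp add: energy_sum antiper_continuous[OF v] sum_distrib_left)
  also have "\<dots> \<le> (\<Sum>i\<in>UNIV. energy T (\<lambda>t. v' t $ i) - weight T (?b i) (\<lambda>t. v t $ i))"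
    by (intro sum_mono c antiper_component v)
  also have "\<dots> = (\<Sum>i\<in>UNIV. integral {0..T} (\<lambda>t. (v' t $ i)\<^sup>2 - ?b i t * (v t $ i)\<^sup>2))"
    unfolding energy_def weight_def
    by (intro sum.cong refl integral_diff[symmetric] integrable_continuous_real ci)
  also have "\<dots> = integral {0..T} (\<lambda>t. \<Sum>i\<in>UNIV. (v' t $ i)\<^sup>2 - ?b i t * (v t $ i)\<^sup>2)"
    by (intro integral_sum[symmetric] integrable_continuous_real ci) auto
  also have "\<dots> \<le> qform T P v v'"
    unfolding qform_def
  proof (rule integral_le)
    show "(\<Sum>i\<in>UNIV. (v' t $ i)\<^sup>2 - ?b i t * (v t $ i)\<^sup>2) \<le> (norm (v' t))\<^sup>2 - (P t *v v t) \<bullet> v t" for t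
      using diagonal_comparison[OF diag le, of t "v t"] by (simp add: norm_power2_sum sum_subtractf)
  qed (intro integrable_continuous_real ci)+
  finally show ?thesis .
qed

section \<open>Perturbation in the integral norm\<close>

lemma quadratic_entrywise_bound:
  fixes A :: "real^'n^'n"
  shows "(A *v x) \<bullet> x \<le> (\<Sum>i\<in>UNIV. \<Sum>j\<in>UNIV. \<bar>A $ i $ j\<bar>) * (norm x)\<^sup>2"
proof -
  have "(A *v x) \<bullet> x = (\<Sum>i\<in>UNIV. \<Sum>j\<in>UNIV. A $ i $ j * x $ j * x $ i)"
    by (simp add: inner_vec_def matrix_vector_mult_def sum_distrib_right)
  also have "\<dots> \<le> (\<Sum>i\<in>UNIV. \<Sum>j\<in>UNIV. \<bar>A $ i $ j\<bar> * (norm x)\<^sup>2)"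
  proof (intro sum_mono)
    fix i j
    have "A $ i $ j * x $ j * x $ i \<le> \<bar>A $ i $ j\<bar> * (\<bar>x $ j\<bar> * \<bar>x $ i\<bar>)"
      by (metis abs_ge_self abs_mult mult.assoc)
    also have "\<dots> \<le> \<bar>A $ i $ j\<bar> * (norm x * norm x)"
      by (intro mult_left_mono mult_mono component_le_norm_cart) auto
    finally show "A $ i $ j * x $ j * x $ i \<le> \<bar>A $ i $ j\<bar> * (norm x)\<^sup>2" by (simp add: power2_eq_square)
  qed
  also have "\<dots> = (\<Sum>i\<in>UNIV. \<Sum>j\<in>UNIV. \<bar>A $ i $ j\<bar>) * (norm x)\<^sup>2" by (simp add: sum_distrib_right)
  finally show ?thesis .
qed

text \<open>By the sup bound, \<open>(norm (v t))\<^sup>2\<close> is at most \<open>T\<close> times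
  the energy and leaves the integral; what remains are the integrals of the entries of
  \<open>P - Q\<close>, one \<open>e\<close> for each.\<close>

lemma coercive_perturbation:
  fixes P Q :: "real \<Rightarrow> real^'n^'n"
  assumes P: "continuous_on {0..T} P" and Q: "continuous_on {0..T} Q"
    and close: "\<And>i j. integral {0..T} (\<lambda>t. \<bar>P t $ i $ j - Q t $ i $ j\<bar>) \<le> e"
    and v: "antiper T v v'"
    and coer: "c * integral {0..T} (\<lambda>t. (norm (v' t))\<^sup>2) \<le> qform T P v v'"
    and T: "0 \<le> T"
  shows "(c - (real CARD('n))\<^sup>2 * e * T) * integral {0..T} (\<lambda>t. (norm (v' t))\<^sup>2) \<le> qform T Q v v'"
proof -
  let ?N = "integral {0..T} (\<lambda>t. (norm (v' t))\<^sup>2)"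
  let ?D = "\<lambda>t. \<Sum>i\<in>UNIV. \<Sum>j\<in>UNIV. \<bar>P t $ i $ j - Q t $ i $ j\<bar>"
  note ci = continuous_intros continuous_on_matrix_vector P Q antiper_continuous[OF v]
  have N0: "0 \<le> ?N" by (intro integral_nonneg integrable_continuous_real ci) auto
  have "integral {0..T} ?D = (\<Sum>i\<in>UNIV. \<Sum>j\<in>UNIV. integral {0..T} (\<lambda>t. \<bar>P t $ i $ j - Q t $ i $ j\<bar>))"
  proof -
    have "integral {0..T} ?D = (\<Sum>i\<in>UNIV. integral {0..T} (\<lambda>t. \<Sum>j\<in>UNIV. \<bar>P t $ i $ j - Q t $ i $ j\<bar>))"
      by (intro integral_sum integrable_continuous_real ci) auto
    also have "\<dots> = (\<Sum>i\<in>UNIV. \<Sum>j\<in>UNIV. integral {0..T} (\<lambda>t. \<bar>P t $ i $ j - Q t $ i $ j\<bar>))"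
      by (intro sum.cong refl integral_sum integrable_continuous_real ci) auto
    finally show ?thesis .
  qed
  also have "\<dots> \<le> (\<Sum>i\<in>(UNIV :: 'n set). \<Sum>j\<in>(UNIV :: 'n set). e)" by (intro sum_mono close)
  also have "\<dots> = (real CARD('n))\<^sup>2 * e" by (simp add: power2_eq_square)
  finally have D: "integral {0..T} ?D \<le> (real CARD('n))\<^sup>2 * e" .
  have "qform T P v v' \<le> integral {0..T} (\<lambda>t. ((norm (v' t))\<^sup>2 - (Q t *v v t) \<bullet> v t) + ?D t * (T * ?N))"
    unfolding qform_def
  proof (rule integral_le)
    fix t assume t: "t \<in> {0..T}"
    have "((Q t - P t) *v v t) \<bullet> v t \<le> (\<Sum>i\<in>UNIV. \<Sum>j\<in>UNIV. \<bar>(Q t - P t) $ i $ j\<bar>) * (norm (v t))\<^sup>2"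
      by (rule quadratic_entrywise_bound)
    also have "\<dots> = ?D t * (norm (v t))\<^sup>2" by (simp add: abs_minus_commute)
    also have "\<dots> \<le> ?D t * (T * ?N)"
      by (intro mult_left_mono antiper_sup_bound[OF v t] sum_nonneg) auto
    finally show "(norm (v' t))\<^sup>2 - (P t *v v t) \<bullet> v t
       \<le> ((norm (v' t))\<^sup>2 - (Q t *v v t) \<bullet> v t) + ?D t * (T * ?N)"
      by (simp add: matrix_vector_mult_diff_rdistrib inner_diff_left)
  qed (intro integrable_continuous_real ci)+
  also have "\<dots> = qform T Q v v' + integral {0..T} (\<lambda>t. ?D t * (T * ?N))"
    unfolding qform_def by (intro integral_add integrable_continuous_real ci)
  also have "integral {0..T} (\<lambda>t. ?D t * (T * ?N)) = integral {0..T} ?D * (T * ?N)"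
    by (rule integral_mult_left)
  also have "\<dots> \<le> (real CARD('n))\<^sup>2 * e * (T * ?N)"
    using N0 T by (intro mult_right_mono D) auto
  finally show ?thesis using coer by (simp add: algebra_simps)
qed

theorem theorem3p2:
  fixes T :: real and P B :: "real \<Rightarrow> real^'n^'n" and p :: "'n \<Rightarrow> ereal"
  assumes "0 < T"
    and "P \<in> Lambda T"
    and "\<And>t i j. i \<noteq> j \<Longrightarrow> B t $ i $ j = 0"
    and "\<And>i. continuous_on UNIV (\<lambda>t. B t $ i $ i)"
    and "\<And>i t. B (t + T) $ i $ i = B t $ i $ i"
    and "\<And>i. 1 \<le> p i"
    and "\<And>t. loewner_le (P t) (B t)"
    and "\<And>i. 1 < p i \<Longrightarrow> Lp_norm (p i) T (\<lambda>t. max (B t $ i $ i) 0) < beta_ant (p i) T"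
    and "\<And>i. p i = 1 \<Longrightarrow> Lp_norm (p i) T (\<lambda>t. max (B t $ i $ i) 0) \<le> beta_ant (p i) T"
  shows "stably_bounded T P"
proof -
  note T = assms(1)
  interpret P: periodic_system T P by unfold_locales (use assms in auto)
  have cB: "continuous_on {0..T} (\<lambda>t. B t $ i $ i)" for i
    using assms(4) continuous_on_subset by blast
  have "\<exists>c>0. \<forall>v v'. antiper T v v' \<longrightarrow>
      c * energy T v' \<le> energy T v' - weight T (\<lambda>t. max (B t $ i $ i) 0) v" for i
  proof (rule scalar_coercive[OF T, of "p i"])
    show "continuous_on {0..T} (\<lambda>t. max (B t $ i $ i) 0)" by (intro continuous_intros cB)
    show "max (B 0 $ i $ i) 0 = max (B T $ i $ i) 0" using assms(5)[of 0 i] by simp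
  qed (use assms in auto)
  then obtain c0 where c0: "\<And>i. 0 < c0 i" "\<And>i v v'. antiper T v v' \<Longrightarrow>
      c0 i * energy T v' \<le> energy T v' - weight T (\<lambda>t. max (B t $ i $ i) 0) v"
    by metis
  define c where "c = Min (range c0)"
  have c: "0 < c" using c0(1) by (simp add: c_def)
  have scal: "c * energy T v' \<le> energy T v' - weight T (\<lambda>t. max (B t $ i $ i) 0) v"
    if v: "antiper T v v'" for i v v'
  proof -
    have "c * energy T v' \<le> c0 i * energy T v'"
      by (intro mult_right_mono energy_nonneg antiper_continuous(2)[OF v]) (simp add: c_def)
    also note c0(2)[OF v]
    finally show ?thesis .
  qed
  have coerP: "c * integral {0..T} (\<lambda>t. (norm (v' t))\<^sup>2) \<le> qform T P v v'" if "antiper T v v'" for v v'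
    by (rule coercive_of_diagonal_bound[OF P.contQ assms(3) cB assms(7) scal that])
  \<comment> \<open>Chosen so that the loss in \<open>coercive_perturbation\<close> is exactly
    \<open>c / 2\<close>.\<close>
  define e where "e = c / (2 * (real CARD('n))\<^sup>2 * T)"
  have e: "0 < e" using c T by (simp add: e_def)
  show ?thesis
    unfolding stably_bounded_def
  proof (intro exI[of _ e] conjI ballI impI allI e)
    fix Q u
    assume Q: "Q \<in> Lambda T" and u: "system_solution Q u"
      and close: "Max (range (\<lambda>(i, j). integral {0..T} (\<lambda>t. \<bar>P t $ i $ j - Q t $ i $ j\<bar>))) < e"
    interpret Q: periodic_system T Q by unfold_locales (use T Q in auto)
    have le: "integral {0..T} (\<lambda>t. \<bar>P t $ i $ j - Q t $ i $ j\<bar>) \<le> e" for i j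
    proof -
      have "integral {0..T} (\<lambda>t. \<bar>P t $ i $ j - Q t $ i $ j\<bar>)
          \<le> Max (range (\<lambda>(i, j). integral {0..T} (\<lambda>t. \<bar>P t $ i $ j - Q t $ i $ j\<bar>)))"
        by (rule Max_ge) (auto intro!: image_eqI[of _ _ "(i, j)"])
      then show ?thesis using close by linarith
    qed
    have ce: "c - (real CARD('n))\<^sup>2 * e * T = c / 2" using T by (simp add: e_def field_simps)
    show "bounded (range u)"
    proof (rule Q.coercive_imp_bounded[OF u, of "c / 2"])
      show "c / 2 * integral {0..T} (\<lambda>t. (norm (v' t))\<^sup>2) \<le> qform T Q v v'" if v: "antiper T v v'" for v v'
        using coercive_perturbation[OF P.contQ Q.contQ le v coerP[OF v]] T by (simp add: ce)
    qed (use c in simp)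
  qed
qed

end
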